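(* For every $m,w\in\mathbb{N}$ with $m>0$ there is a bijection $\varphi:\mathscr{R}_w\to\mathscr{M}_w$ that satisfies both of the following properties. Divisibility: $\mathbf{u}$ divides $\varphi(\mathbf{u})$ for every monomial $\mathbf{u}\in\mathscr{R}_w$. Non cancellation: for every bijection $\hat\varphi:\mathscr{R}_w\to\mathscr{M}_w$ with the same multiset of multipliers as $\varphi$, the permutation $\hat\varphi^{-1}\circ\varphi$ of $\mathscr{R}_w$ is even.
   Context: $\mathbb{N}$ contains $0$. Monomials are in the variables $x,y,z$, with weights $\mathrm{wt}(x)=1$, $\mathrm{wt}(y)=2$, $\mathrm{wt}(z)=3$, so $x^ay^bz^c$ has weight $a+2b+3c$. For given $m>0$ and $w$: $\mathscr{R}_w$ is the set of monomials $x^ay^bz^c$ of weight $w$ with $a+b\le 3m-3$ (the monomial basis of the weight $w$ part of $R=\Bbbk[x,y,z]/(x,y)^{3m-2}$); $\mathscr{M}_w$ is the set of monomials $x^iy^jz^k$ of weight $w+3m$ with $i+j\le 3m-3$ and $i+j+k\ge 3m-2$ (the monomial basis of the weight $w+3m$ part of $M=(x,y,z)^{3m-2}/(x,y)^{3m-2}$). The multiset of multipliers of a bijection $\psi:\mathscr{R}_w\to\mathscr{M}_w$ is the multiset of quotients $\psi(\mathbf{u})/\mathbf{u}$, $\mathbf{u}\in\mathscr{R}_w$ (equivalently, of differences of exponent vectors in $\mathbb{Z}^3$), counted with multiplicity. *)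

theory Defs
  imports "HOL-Library.Multiset" "HOL-Library.Product_Plus" "HOL-Combinatorics.Permutations"
begin

text \<open>The monomial \<open>x^a y^b z^c\<close> is represented by its exponent vector \<open>(a, b, c)\<close>;
  the product of monomials is then the componentwise sum provided by \<open>Product_Plus\<close>.\<close>

type_synonym monomial = "nat \<times> nat \<times> nat"

definition wt :: "monomial \<Rightarrow> nat" where
  "wt = (\<lambda>(a, b, c). a + 2 * b + 3 * c)"

definition mon_divides :: "monomial \<Rightarrow> monomial \<Rightarrow> bool" where
  "mon_divides u v \<longleftrightarrow> (\<exists>t. v = u + t)"

text \<open>Both sets below are meant for \<open>m > 0\<close>, where the subtractions do not truncate.\<close>

definition R_mons :: "nat \<Rightarrow> nat \<Rightarrow> monomial set" where
  "R_mons m w = {(a, b, c) | a b c. wt (a, b, c) = w \<and> a + b \<le> 3 * m - 3}"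

definition M_mons :: "nat \<Rightarrow> nat \<Rightarrow> monomial set" where
  "M_mons m w = {(i, j, k) | i j k.
     wt (i, j, k) = w + 3 * m \<and> i + j \<le> 3 * m - 3 \<and> i + j + k \<ge> 3 * m - 2}"

text \<open>The quotient \<open>v / u\<close> as a Laurent monomial, i.e. the difference of exponent vectors,
  with possibly negative entries.\<close>

definition mon_quot :: "monomial \<Rightarrow> monomial \<Rightarrow> int \<times> int \<times> int" where
  "mon_quot = (\<lambda>(i, j, k) (a, b, c). (int i - int a, int j - int b, int k - int c))"

definition multipliers :: "monomial set \<Rightarrow> (monomial \<Rightarrow> monomial) \<Rightarrow> (int \<times> int \<times> int) multiset" where
  "multipliers A f = image_mset (\<lambda>u. mon_quot (f u) u) (mset_set A)"

text \<open>For bijections \<open>f, g : A \<rightarrow> B\<close>, the permutation \<open>g\<inverse> \<circ> f\<close> of \<open>A\<close>, extended by the identity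
  outside \<open>A\<close>, as \<open>permutes\<close> and \<open>evenperm\<close> require.\<close>

definition quot_perm :: "'a set \<Rightarrow> ('a \<Rightarrow> 'b) \<Rightarrow> ('a \<Rightarrow> 'b) \<Rightarrow> 'a \<Rightarrow> 'a" where
  "quot_perm A g f = restrict_id (inv_into A g \<circ> f) A"

text \<open>\<open>mset_set\<close> and \<open>evenperm\<close> are only meaningful for finite sets and for finitely supported
  permutations; the following lemmas show that we are in that situation.\<close>

lemma finite_R_mons: "finite (R_mons m w)"
  by (rule finite_subset[of _ "{..w} \<times> {..w} \<times> {..w}"]) (auto simp: R_mons_def wt_def)

lemma quot_perm_permutes:
  assumes "bij_betw f A B" "bij_betw g A B"
  shows "quot_perm A g f permutes A"
  unfolding quot_perm_def
  by (intro permutes_restrict_id bij_betw_trans[OF assms(1)] bij_betw_inv_into assms(2))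

lemma permutation_quot_perm:
  assumes "bij_betw f (R_mons m w) B" "bij_betw g (R_mons m w) B"
  shows "permutation (quot_perm (R_mons m w) g f)"
  using quot_perm_permutes[OF assms] finite_R_mons permutation_permutes by blast

end

theory Submission
  imports Defs
begin

text \<open>Write \<open>N = 3 m - 3\<close>. Since the weight determines the exponent of \<open>z\<close>, a monomial is a lattice point
\<open>(a, b)\<close> of the triangle \<open>a, b \<ge> 0\<close>, \<open>a + b \<le> N\<close>, with \<open>a - b\<close> congruent to \<open>w\<close> modulo 3. The first set is cut
out by \<open>a + 2 b \<le> w\<close>, the second one by \<open>2 i + j \<ge> g\<close> with \<open>g = 2 N - w\<close>. A multiplier is determined by
\<open>p = i - a\<close> and \<open>q = j - b\<close>, and divisibility means \<open>p, q \<ge> 0\<close> and \<open>p + 2 q \<le> N + 3\<close>.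

The matching is explicit. Let \<open>N\<^sub>1\<close> be the largest multiple of 3 that is below \<open>g\<close>, or \<open>N\<close> if that is
smaller, and let \<open>s = g - N\<^sub>1\<close>. The source points with \<open>a + 2 b \<le> N\<^sub>1 - s\<close> are matched with the target
points with \<open>i + j \<le> N\<^sub>1\<close>: up to rounding this is the affine map that doubles \<open>b\<close>; it sends row \<open>b\<close> to
the rows \<open>2 b\<close> and \<open>2 b + 1\<close>. What is left over in a column \<open>a \<le> N\<^sub>1\<close> consists of equally many source
points and target points, and a vertical translation matches them. To the right of \<open>N\<^sub>1\<close> all points
stay where they are.

Non cancellation is an optimality argument. A cost function of the form \<open>g(u) + h(v) + K(v / u)\<close> has the
same sum over any two bijections with the same multiset of multipliers. If the matching \<open>\<phi>\<close> sends every
\<open>u\<close> to a cheapest \<open>v\<close> among those that can be reached by a multiplier of \<open>\<phi>\<close>, then a bijection \<open>\<psi>\<close> with the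
multipliers of \<open>\<phi>\<close> uses only such cheapest pairs, too. Up to rounding, \<open>\<phi>\<close> is the optimal transport for
the quadratic cost \<open>x\<^sup>2 + 2 y\<^sup>2\<close>, where \<open>x = a + 2 b - g + 2 p\<close> and \<open>y = a - g + 2 (p + q)\<close>: the stretched
part has \<open>x = y = 0\<close>, and the translated part has \<open>y = 0\<close> and \<open>p = 0\<close>, which is as close to \<open>x = 0\<close> as
\<open>p \<ge> 0\<close> permits. The rounding is absorbed into potentials that depend on the column modulo 6.

These potentials leave few ties. In certain pairs of neighbouring columns a chain of points can slide
by one place, after which one point of the left column crosses over to the right one. The move of the
crossing by one place along the chain is a 3-cycle. So every \<open>\<psi>\<close> can be turned into \<open>\<phi>\<close> by 3-cycles, and
the permutation that compares them is even.\<close>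

section \<open>Matchings with equal multipliers\<close>

text \<open>Summing the cost over a bijection turns the contributions of \<open>g\<close> and \<open>h\<close> into constants and makes the
rest depend on the multiset of multipliers only, so the two sums agree, and a termwise inequality between
them has to be an equality.\<close>

lemma tight_of_same_multiset:
  fixes c :: "'a \<Rightarrow> 'b \<Rightarrow> int"
  assumes fin: "finite A" and phi: "bij_betw \<phi> A B" and psi: "bij_betw \<psi> A B"
    and same: "image_mset (\<lambda>u. \<mu> (\<psi> u) u) (mset_set A) = image_mset (\<lambda>u. \<mu> (\<phi> u) u) (mset_set A)"
    and c: "\<And>u v. u \<in> A \<Longrightarrow> v \<in> B \<Longrightarrow> c u v = g u + h v + K (\<mu> v u)"
    and le: "\<And>u. u \<in> A \<Longrightarrow> c u (\<phi> u) \<le> c u (\<psi> u)"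
    and u: "u \<in> A"
  shows "c u (\<psi> u) = c u (\<phi> u)"
proof -
  have total: "(\<Sum>u\<in>A. c u (f u)) = sum g A + sum h B + (\<Sum>\<nu>\<in>#image_mset (\<lambda>u. \<mu> (f u) u) (mset_set A). K \<nu>)"
    if f: "bij_betw f A B" for f
  proof -
    have "(\<Sum>u\<in>A. c u (f u)) = (\<Sum>u\<in>A. g u + h (f u) + K (\<mu> (f u) u))"
      using f by (intro sum.cong) (auto simp: c bij_betw_apply)
    also have "\<dots> = sum g A + (\<Sum>u\<in>A. h (f u)) + (\<Sum>u\<in>A. K (\<mu> (f u) u))"
      by (simp add: sum.distrib)
    also have "(\<Sum>u\<in>A. h (f u)) = sum h B"
      by (rule sum.reindex_bij_betw[OF f])
    also have "(\<Sum>u\<in>A. K (\<mu> (f u) u)) = (\<Sum>\<nu>\<in>#image_mset (\<lambda>u. \<mu> (f u) u) (mset_set A). K \<nu>)"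
      by (simp add: sum_unfold_sum_mset image_mset.compositionality comp_def)
    finally show ?thesis .
  qed
  have "(\<Sum>u\<in>A. c u (\<phi> u)) = (\<Sum>u\<in>A. c u (\<psi> u))"
    using total[OF phi] total[OF psi] same by simp
  from sum_mono_inv[OF this le u fin] show ?thesis by simp
qed

text \<open>If every bijection with property \<open>P\<close> other than \<open>\<phi>\<close> can be brought closer to \<open>\<phi>\<close> by rotating three of its
values, then all these bijections differ from \<open>\<phi>\<close> by a product of 3-cycles.\<close>

lemma evenperm_by_three_cycles:
  assumes fin: "finite A" and phi: "bij_betw \<phi> A B"
    and step: "\<And>\<psi>. bij_betw \<psi> A B \<Longrightarrow> P \<psi> \<Longrightarrow> \<exists>u\<in>A. \<psi> u \<noteq> \<phi> u \<Longrightarrow>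
      \<exists>x\<in>A. \<exists>y\<in>A. \<exists>z\<in>A. x \<noteq> y \<and> y \<noteq> z \<and> x \<noteq> z \<and> P (\<psi>(x := \<psi> y, y := \<psi> z, z := \<psi> x)) \<and>
        {u\<in>A. (\<psi>(x := \<psi> y, y := \<psi> z, z := \<psi> x)) u \<noteq> \<phi> u} \<subset> {u\<in>A. \<psi> u \<noteq> \<phi> u}"
    and psi: "bij_betw \<psi> A B" "P \<psi>"
  shows "evenperm (quot_perm A \<psi> \<phi>)"
  using psi
proof (induction "card {u\<in>A. \<psi> u \<noteq> \<phi> u}" arbitrary: \<psi> rule: less_induct)
  case less
  show ?case
  proof (cases "\<exists>u\<in>A. \<psi> u \<noteq> \<phi> u")
    case False
    have "quot_perm A \<psi> \<phi> = id"
    proof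
      fix u show "quot_perm A \<psi> \<phi> u = id u"
        using False less.prems(1) by (auto simp: quot_perm_def restrict_id_def bij_betw_def intro: inv_into_f_eq)
    qed
    then show ?thesis by (simp add: evenperm_id)
  next
    case True
    obtain x y z where xyz: "x \<in> A" "y \<in> A" "z \<in> A" "x \<noteq> y" "y \<noteq> z" "x \<noteq> z"
      and P': "P (\<psi>(x := \<psi> y, y := \<psi> z, z := \<psi> x))"
      and smaller: "{u\<in>A. (\<psi>(x := \<psi> y, y := \<psi> z, z := \<psi> x)) u \<noteq> \<phi> u} \<subset> {u\<in>A. \<psi> u \<noteq> \<phi> u}"
      using step[OF less.prems True] by (elim bexE conjE) (rule that)
    define \<tau> where "\<tau> = transpose x y \<circ> transpose y z"
    define \<psi>' where "\<psi>' = \<psi>(x := \<psi> y, y := \<psi> z, z := \<psi> x)"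
    have \<psi>'_eq: "\<psi>' = \<psi> \<circ> \<tau>"
      using xyz by (auto simp: \<psi>'_def \<tau>_def transpose_def fun_eq_iff)
    have \<tau>: "\<tau> permutes A"
      unfolding \<tau>_def by (intro permutes_compose permutes_swap_id xyz)
    have bij': "bij_betw \<psi>' A B"
      unfolding \<psi>'_eq using bij_betw_trans[OF permutes_imp_bij[OF \<tau>] less.prems(1)] .
    have fewer: "card {u\<in>A. \<psi>' u \<noteq> \<phi> u} < card {u\<in>A. \<psi> u \<noteq> \<phi> u}"
      unfolding \<psi>'_def by (rule psubset_card_mono[OF _ smaller]) (use fin in simp)
    have "P \<psi>'" unfolding \<psi>'_def by (rule P')
    from less.hyps[OF fewer bij' this] have even': "evenperm (quot_perm A \<psi>' \<phi>)" .
    have "quot_perm A \<psi> \<phi> = \<tau> \<circ> quot_perm A \<psi>' \<phi>"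
    proof
      fix u
      show "quot_perm A \<psi> \<phi> u = (\<tau> \<circ> quot_perm A \<psi>' \<phi>) u"
      proof (cases "u \<in> A")
        case True
        then have "\<phi> u \<in> B" using phi by (auto simp: bij_betw_def)
        then have v: "inv_into A \<psi>' (\<phi> u) \<in> A" "\<psi> (\<tau> (inv_into A \<psi>' (\<phi> u))) = \<phi> u"
          using bij' f_inv_into_f[of "\<phi> u" \<psi>' A] inv_into_into[of "\<phi> u" \<psi>' A]
          by (auto simp: bij_betw_def \<psi>'_eq)
        have "inv_into A \<psi> (\<phi> u) = \<tau> (inv_into A \<psi>' (\<phi> u))"
          using v less.prems(1) permutes_in_image[OF \<tau>] by (intro inv_into_f_eq) (auto simp: bij_betw_def)
        then show ?thesis using True by (simp add: quot_perm_def restrict_id_def)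
      next
        case False
        then show ?thesis using \<tau> by (simp add: quot_perm_def restrict_id_def permutes_def)
      qed
    qed
    moreover have "evenperm \<tau>"
      unfolding \<tau>_def using xyz by (simp add: evenperm_comp evenperm_swap permutation_swap_id)
    moreover have "permutation \<tau>" "permutation (quot_perm A \<psi>' \<phi>)"
      using \<tau> quot_perm_permutes[OF phi bij'] fin permutation_permutes by blast+
    ultimately show ?thesis using even' by (simp add: evenperm_comp)
  qed
qed

text \<open>The ties of the cost function. A source point has the coordinates \<open>a\<close> (column) and \<open>x\<close> (height above the
stretched part), its image has the coordinates \<open>t\<close> (column) and \<open>z\<close> (level). In a column \<open>a\<close> that is 2
modulo 6 a point may go one place (3 levels) higher than \<open>\<phi>\<close> puts it, or cross over to column \<open>a + 1\<close>; in
a column that is 3 modulo 6 a point may go one place lower. Only columns with \<open>a < 0\<close>, where the matching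
is not the identity, have ties. The flag \<open>cr\<close> says whether crossings occur.\<close>

definition slide :: "bool \<Rightarrow> int \<Rightarrow> int \<Rightarrow> int \<Rightarrow> int \<Rightarrow> bool" where
  "slide cr a x t z \<longleftrightarrow>
     a mod 6 = 2 \<and> a < 0 \<and> x \<ge> 0 \<and> t = a \<and> 2 * z = x + 2 \<or>
     cr \<and> a mod 6 = 2 \<and> a < 0 \<and> x > 0 \<and> t = a + 1 \<and> 2 * z = x \<or>
     a mod 6 = 3 \<and> a < 0 \<and> x > 0 \<and> t = a \<and> 2 * z = x - 3"

text \<open>In a pair of columns \<open>a\<close>, \<open>a + 1\<close> with ties, let \<open>u\<^sub>0, u\<^sub>1, \<dots>\<close> be the source points of height \<open>0, 6, \<dots>\<close> in
column \<open>a\<close> and \<open>v\<^sub>0, v\<^sub>1, \<dots>\<close> those of height \<open>3, 9, \<dots>\<close> in column \<open>a + 1\<close>. Let \<open>x\<^sub>k\<close> be the image of \<open>u\<^sub>k\<close> for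
\<open>k \<ge> 1\<close>, let \<open>y\<^sub>k\<close> be the image of \<open>v\<^sub>k\<^sub>-\<^sub>1\<close> for \<open>k \<ge> 1\<close>, and let \<open>y\<^sub>0\<close> be the point below \<open>y\<^sub>1\<close>. The ties are
\<open>u\<^sub>k \<mapsto> x\<^sub>k\<^sub>+\<^sub>1\<close>, \<open>u\<^sub>k \<mapsto> y\<^sub>k\<close> and \<open>v\<^sub>k \<mapsto> y\<^sub>k\<close>. A bijection that uses them contains a crossing \<open>u\<^sub>k \<mapsto> y\<^sub>k\<close> with
\<open>k \<ge> 1\<close>, since otherwise the topmost point that moves up would have no room. Then \<open>x\<^sub>k\<close> has to come from
\<open>u\<^sub>k\<^sub>-\<^sub>1\<close>, and \<open>v\<^sub>k\<^sub>-\<^sub>1\<close> has to go to \<open>y\<^sub>k\<^sub>-\<^sub>1\<close>. Rotating the values at \<open>u\<^sub>k\<close>, \<open>u\<^sub>k\<^sub>-\<^sub>1\<close> and \<open>v\<^sub>k\<^sub>-\<^sub>1\<close> gives the values of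
\<open>\<phi>\<close> at \<open>u\<^sub>k\<close> and \<open>v\<^sub>k\<^sub>-\<^sub>1\<close> and moves the crossing down to \<open>u\<^sub>k\<^sub>-\<^sub>1 \<mapsto> y\<^sub>k\<^sub>-\<^sub>1\<close>, which for \<open>k = 1\<close> is the value of \<open>\<phi>\<close>.\<close>

lemma even_slides:
  fixes \<alpha> \<xi> :: "'a \<Rightarrow> int" and \<tau> \<zeta> :: "'b \<Rightarrow> int"
  assumes fin: "finite A" and phi: "bij_betw \<phi> A B"
    and inj: "\<And>u u'. u \<in> A \<Longrightarrow> u' \<in> A \<Longrightarrow> \<alpha> u = \<alpha> u' \<Longrightarrow> \<xi> u = \<xi> u' \<Longrightarrow> u = u'"
    and inj': "\<And>v v'. v \<in> B \<Longrightarrow> v' \<in> B \<Longrightarrow> \<tau> v = \<tau> v' \<Longrightarrow> \<zeta> v = \<zeta> v' \<Longrightarrow> v = v'"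
    and pos: "\<And>u. u \<in> A \<Longrightarrow> \<xi> u > 0 \<Longrightarrow> \<tau> (\<phi> u) = \<alpha> u"
    and nonpos: "\<And>u. u \<in> A \<Longrightarrow> \<xi> u \<le> 0 \<Longrightarrow> \<zeta> (\<phi> u) \<le> 0"
    and low: "\<And>u. u \<in> A \<Longrightarrow> \<xi> u > 0 \<Longrightarrow> \<alpha> u < 0 \<Longrightarrow> \<alpha> u mod 6 = 2 \<Longrightarrow> 2 * \<zeta> (\<phi> u) = \<xi> u - 4"
    and high: "\<And>u. u \<in> A \<Longrightarrow> \<xi> u > 0 \<Longrightarrow> \<alpha> u < 0 \<Longrightarrow> \<alpha> u mod 6 = 3 \<Longrightarrow> 2 * \<zeta> (\<phi> u) = \<xi> u + 3"
    and base: "\<And>u. u \<in> A \<Longrightarrow> \<xi> u = 0 \<Longrightarrow> \<alpha> u < 0 \<Longrightarrow> \<alpha> u mod 6 = 2 \<Longrightarrow> cr \<Longrightarrow> \<tau> (\<phi> u) = \<alpha> u + 1 \<and> \<zeta> (\<phi> u) = 0"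
    and psi: "bij_betw \<psi> A B"
    and tight: "\<forall>u\<in>A. \<psi> u = \<phi> u \<or> slide cr (\<alpha> u) (\<xi> u) (\<tau> (\<psi> u)) (\<zeta> (\<psi> u))"
  shows "evenperm (quot_perm A \<psi> \<phi>)"
proof -
  define up where "up = (\<lambda>\<psi> u. \<alpha> u mod 6 = 2 \<and> \<alpha> u < 0 \<and> \<xi> u \<ge> 0 \<and> \<tau> (\<psi> u) = \<alpha> u \<and> 2 * \<zeta> (\<psi> u) = \<xi> u + 2)"
  define across where "across = (\<lambda>\<psi> u. \<alpha> u mod 6 = 2 \<and> \<alpha> u < 0 \<and> \<xi> u > 0 \<and> \<tau> (\<psi> u) = \<alpha> u + 1 \<and> 2 * \<zeta> (\<psi> u) = \<xi> u)"
  define down where "down = (\<lambda>\<psi> u. \<alpha> u mod 6 = 3 \<and> \<alpha> u < 0 \<and> \<xi> u > 0 \<and> \<tau> (\<psi> u) = \<alpha> u \<and> 2 * \<zeta> (\<psi> u) = \<xi> u - 3)"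
  define P where "P = (\<lambda>\<psi>. \<forall>u\<in>A. \<psi> u = \<phi> u \<or> up \<psi> u \<or> cr \<and> across \<psi> u \<or> down \<psi> u)"
  have P: "P \<psi>" using tight unfolding P_def slide_def up_def across_def down_def by blast
  have step: "\<exists>x\<in>A. \<exists>y\<in>A. \<exists>z\<in>A. x \<noteq> y \<and> y \<noteq> z \<and> x \<noteq> z \<and> P (\<psi>(x := \<psi> y, y := \<psi> z, z := \<psi> x)) \<and>
        {u\<in>A. (\<psi>(x := \<psi> y, y := \<psi> z, z := \<psi> x)) u \<noteq> \<phi> u} \<subset> {u\<in>A. \<psi> u \<noteq> \<phi> u}"
    if psi: "bij_betw \<psi> A B" and P: "P \<psi>" and moved: "\<exists>u\<in>A. \<psi> u \<noteq> \<phi> u" for \<psi>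
  proof -
    have tight: "\<forall>u\<in>A. \<psi> u = \<phi> u \<or> up \<psi> u \<or> cr \<and> across \<psi> u \<or> down \<psi> u" using P unfolding P_def .
    have phiB: "\<phi> u \<in> B" and psiB: "\<psi> u \<in> B" if "u \<in> A" for u
      using that phi psi by (auto simp: bij_betw_def)
    have phiI: "u = u'" if "u \<in> A" "u' \<in> A" "\<phi> u = \<phi> u'" for u u'
      using that phi by (auto simp: bij_betw_def inj_on_def)
    have psiI: "u = u'" if "u \<in> A" "u' \<in> A" "\<psi> u = \<psi> u'" for u u'
      using that psi by (auto simp: bij_betw_def inj_on_def)
    have phiS: "\<exists>u\<in>A. \<phi> u = v" and psiS: "\<exists>u\<in>A. \<psi> u = v" if "v \<in> B" for v
      using that phi psi unfolding bij_betw_def by (metis imageE)+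
    have ex_across: "\<exists>u\<in>A. cr \<and> across \<psi> u"
    proof (rule ccontr)
      assume "\<not> ?thesis"
      then have tight': "\<psi> u = \<phi> u \<or> up \<psi> u \<or> down \<psi> u" if "u \<in> A" for u using tight that by blast
      (* The topmost point that moves up blocks the place above, whose owner has to move up as well. *)
    have no_up: "\<psi> u = \<phi> u \<or> \<not> up \<psi> u" if "u \<in> A" for u
      proof (rule ccontr)
        assume *: "\<not> ?thesis"
        define U where "U = {u\<in>A. \<psi> u \<noteq> \<phi> u \<and> up \<psi> u}"
        have "finite U" "U \<noteq> {}" using * that fin by (auto simp: U_def)
        then obtain x where x: "x \<in> U" "\<And>y. y \<in> U \<Longrightarrow> \<xi> y \<le> \<xi> x"
          using obtains_MAX[of U \<xi>] by (metis Max_ge finite_imageI imageI)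
        obtain y where y: "y \<in> A" "\<phi> y = \<psi> x"
          using phiS[OF psiB[of x]] x(1) unfolding U_def by blast
        have ux: "up \<psi> x" "x \<in> A" "\<psi> x \<noteq> \<phi> x" using x(1) by (auto simp: U_def)
        have "\<zeta> (\<phi> y) > 0" using y ux by (auto simp: up_def)
        then have "\<xi> y > 0" using nonpos[of y] y(1) by force
        then have "\<alpha> y = \<alpha> x" using pos[of y] y ux by (simp add: up_def)
        then have "\<xi> y = \<xi> x + 6" using low[of y] \<open>\<xi> y > 0\<close> y ux by (simp add: up_def)
        have "\<psi> y \<noteq> \<phi> y" using y psiI[of x y] ux(2,3) by metis
        moreover have "\<not> down \<psi> y" using \<open>\<alpha> y = \<alpha> x\<close> ux by (simp add: up_def down_def)
        ultimately have "y \<in> U" using tight'[of y] y(1) by (auto simp: U_def)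
        then show False using x(2)[of y] \<open>\<xi> y = \<xi> x + 6\<close> by simp
      qed
      (* Without upward moves only downward ones remain; the lowest of them displaces a point that
       would have to move down as well. *)
    define D where "D = {u\<in>A. \<psi> u \<noteq> \<phi> u}"
      have Dd: "down \<psi> u" if "u \<in> D" for u using that tight' no_up by (auto simp: D_def)
      have "finite D" "D \<noteq> {}" using moved fin by (auto simp: D_def)
      then obtain x where x: "x \<in> D" "\<And>y. y \<in> D \<Longrightarrow> \<xi> x \<le> \<xi> y"
        using obtains_MIN[of D \<xi>] by (metis Min_le finite_imageI imageI)
      have dx: "down \<psi> x" "x \<in> A" "\<psi> x \<noteq> \<phi> x" using x(1) Dd by (auto simp: D_def)
      obtain y where y: "y \<in> A" "\<phi> y = \<psi> x"
        using phiS[OF psiB[OF dx(2)]] by blast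
      have "\<psi> y \<noteq> \<phi> y" using y psiI[of x y] dx(2,3) by metis
      then have yD: "y \<in> D" using y(1) by (simp add: D_def)
      then have "\<xi> y > 0" using Dd by (auto simp: down_def)
      then have "\<alpha> y = \<alpha> x" using pos[of y] y dx by (simp add: down_def)
      then have "\<xi> y = \<xi> x - 6" using high[of y] \<open>\<xi> y > 0\<close> y dx by (simp add: down_def)
      then show False using x(2)[OF yD] by simp
    qed
    then obtain x where x: "x \<in> A" "cr" "across \<psi> x" by blast
    (* In the notation above, x, y, z are the source points of indices k, k - 1, k - 1, the last one in
     the right column. *)
  obtain y where y: "y \<in> A" "\<psi> y = \<phi> x"
      using psiS[OF phiB[OF x(1)]] by blast
    obtain z where z: "z \<in> A" "\<phi> z = \<psi> x"
      using phiS[OF psiB[OF x(1)]] by blast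
    have x_ne: "\<psi> x \<noteq> \<phi> x" using pos[of x] x by (auto simp: across_def)
    have "\<xi> z > 0" using nonpos[of z] z x by (force simp: across_def)
    then have az: "\<alpha> z = \<alpha> x + 1" using pos[of z] z x by (simp add: across_def)
    have az': "\<alpha> z mod 6 = 3" "\<alpha> z < 0" using az x(3) unfolding across_def by presburger+
    have xz: "\<xi> z = \<xi> x - 3" using high[OF z(1) \<open>\<xi> z > 0\<close> az'(2,1)] z x by (simp add: across_def)
    have uy: "up \<psi> y"
    proof -
      have "\<psi> y \<noteq> \<phi> y" using phiI[of y x] y x(1) x_ne by metis
      moreover have "\<tau> (\<psi> y) = \<alpha> x" using pos[of x] x y by (simp add: across_def)
      then have "\<not> across \<psi> y" "\<not> down \<psi> y" using x(3) unfolding across_def down_def by presburger+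
      ultimately show ?thesis using tight y(1) by blast
    qed
    have ay: "\<alpha> y = \<alpha> x" using uy pos[of x] x y by (simp add: up_def across_def)
    have xy: "\<xi> y = \<xi> x - 6" using uy low[of x] x y by (simp add: up_def across_def)
    have dz: "down \<psi> z"
    proof -
      have "\<psi> z \<noteq> \<phi> z" using psiI[of z x] z x(1) az by (metis add.right_neutral add_left_cancel zero_neq_one)
      moreover have "\<not> across \<psi> z" "\<not> up \<psi> z" using az' by (simp_all add: across_def up_def)
      ultimately show ?thesis using tight z(1) by blast
    qed
    have ne: "x \<noteq> y" "y \<noteq> z" "x \<noteq> z" using az ay xy by auto
    let ?\<psi>' = "\<psi>(x := \<psi> y, y := \<psi> z, z := \<psi> x)"
    have vals: "?\<psi>' x = \<phi> x" "?\<psi>' z = \<phi> z" "?\<psi>' y = \<psi> z" using ne y z by auto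
    have oth: "?\<psi>' u = \<psi> u" if "u \<noteq> x" "u \<noteq> y" "u \<noteq> z" for u using that by simp
    have py: "?\<psi>' y = \<phi> y \<or> across ?\<psi>' y"
    proof (cases "\<xi> y = 0")
      case True
      have b: "\<tau> (\<phi> y) = \<alpha> y + 1" "\<zeta> (\<phi> y) = 0" using base[of y] True uy x(2) y(1) by (auto simp: up_def)
      have "\<tau> (\<psi> z) = \<alpha> y + 1" "\<zeta> (\<psi> z) = 0" using dz az ay xz xy True by (auto simp: down_def)
      then have "\<psi> z = \<phi> y" using inj'[of "\<psi> z" "\<phi> y"] b psiB[OF z(1)] phiB[OF y(1)] by auto
      then show ?thesis using vals by simp
    next
      case False
      then show ?thesis using uy dz az ay xz xy vals unfolding across_def up_def down_def by auto
    qed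
    have T1: "\<forall>u\<in>A. ?\<psi>' u = \<phi> u \<or> up ?\<psi>' u \<or> cr \<and> across ?\<psi>' u \<or> down ?\<psi>' u"
    proof
      fix u assume "u \<in> A"
      show "?\<psi>' u = \<phi> u \<or> up ?\<psi>' u \<or> cr \<and> across ?\<psi>' u \<or> down ?\<psi>' u"
      proof (cases "u = x \<or> u = y \<or> u = z")
        case True then show ?thesis using vals py x(2) by blast
      next
        case False
        then have eq: "?\<psi>' u = \<psi> u" using oth by blast
        show ?thesis using bspec[OF tight \<open>u \<in> A\<close>] unfolding up_def across_def down_def eq .
      qed
    qed
    have T2: "{u\<in>A. ?\<psi>' u \<noteq> \<phi> u} \<subset> {u\<in>A. \<psi> u \<noteq> \<phi> u}"
    proof
      have "\<psi> y \<noteq> \<phi> y" using phiI[of y x] y x(1) ne(1) by metis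
      show "{u\<in>A. ?\<psi>' u \<noteq> \<phi> u} \<subseteq> {u\<in>A. \<psi> u \<noteq> \<phi> u}"
      proof
        fix u assume u: "u \<in> {u\<in>A. ?\<psi>' u \<noteq> \<phi> u}"
        then have "u \<noteq> x" "u \<noteq> z" using vals(1,2) by blast+
        then show "u \<in> {u\<in>A. \<psi> u \<noteq> \<phi> u}"
          using u oth[of u] \<open>\<psi> y \<noteq> \<phi> y\<close> by (cases "u = y") simp_all
      qed
      show "{u\<in>A. ?\<psi>' u \<noteq> \<phi> u} \<noteq> {u\<in>A. \<psi> u \<noteq> \<phi> u}" using x(1) x_ne vals(1) by blast
    qed
    have "P ?\<psi>'" using T1 unfolding P_def .
    then show ?thesis
      by (intro bexI[OF _ x(1)] bexI[OF _ y(1)] bexI[OF _ z(1)] conjI ne T2)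
  qed
  show ?thesis by (rule evenperm_by_three_cycles[OF fin phi step psi P])
qed

section \<open>The matching in coordinates\<close>

text \<open>From now on a source point is given by its column \<open>\<alpha> = a - g\<close> and its height \<open>\<xi> = a + 2 b - (N\<^sub>1 - s)\<close>, a
target point by its column \<open>i - g\<close> and its level \<open>\<zeta> = i + j - N\<^sub>1\<close>. The stretched part consists of the
points with \<open>\<xi> \<le> 0\<close>. Heights are divisible by 3 and have the parity of \<open>\<alpha>\<close>, and \<open>\<zeta>\<close> is congruent to
\<open>- (i - g)\<close> modulo 3. The next two residues describe the rounding in the stretched part: the first one is
\<open>a\<close> modulo 3, and the second one tells which of the rows \<open>2 b\<close> and \<open>2 b + 1\<close> is the target.\<close>

definition res3 :: "int \<Rightarrow> int \<Rightarrow> int" where "res3 s \<alpha> = (\<alpha> + s) mod 3"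
definition res2 :: "int \<Rightarrow> int \<Rightarrow> int" where "res2 s \<alpha> = (res3 s \<alpha> + \<alpha>) mod 2"

text \<open>The value of \<open>y = \<alpha> + 2 p + 2 q\<close> that the vertical translation of a column produces. Because of \<open>p = 0\<close> and
\<open>3 dvd q\<close> it is prescribed modulo 6; which representative occurs depends on where the two parts
of the column to be matched begin. The outliers \<open>-4\<close> and \<open>3\<close>, in place of \<open>2\<close> and \<open>-3\<close>, cause the ties.\<close>

definition offset :: "int \<Rightarrow> int" where
  "offset \<alpha> = (if \<alpha> mod 6 = 2 then - 4 else if \<alpha> mod 6 = 3 then 3 else if \<alpha> mod 6 = 4 then - 2
     else if \<alpha> mod 6 = 5 then - 1 else \<alpha> mod 6)"

text \<open>The horizontal step and the target level of the matching. In terms of \<open>x = \<xi> - 2 s + 2 p\<close> and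
\<open>y = 2 \<zeta> - \<xi>\<close>, the stretched part has \<open>x = - (res3 s \<alpha> + res2 s \<alpha>)\<close> and \<open>y = res2 s \<alpha> - res3 s \<alpha>\<close>. For \<open>\<alpha> \<ge> 2\<close> the
value \<open>y = \<alpha>\<close> means that the point stays where it is; for \<open>-2 \<le> \<alpha> \<le> 1\<close> this is also what \<open>offset\<close> gives.\<close>

definition hstep :: "int \<Rightarrow> int \<Rightarrow> int \<Rightarrow> int" where
  "hstep s \<alpha> \<xi> = (if \<xi> \<le> 0 then (2*s - \<xi> - (res3 s \<alpha> + res2 s \<alpha>)) div 2 else 0)"

definition layer :: "int \<Rightarrow> int \<Rightarrow> int \<Rightarrow> int" where
  "layer s \<alpha> \<xi> = (\<xi> + (if \<xi> \<le> 0 then res2 s \<alpha> - res3 s \<alpha> else if \<alpha> \<ge> 2 then \<alpha> else offset \<alpha>)) div 2"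

lemma residue_bounds:
  "0 \<le> res3 s \<alpha>" "res3 s \<alpha> \<le> 2" "0 \<le> res2 s \<alpha>" "res2 s \<alpha> \<le> 1" "even (res3 s \<alpha> + res2 s \<alpha> + \<alpha>)" "3 dvd (res3 s \<alpha> - \<alpha> - s)"
proof -
  have mod2: "0 \<le> k mod 2 \<and> k mod 2 \<le> 1 \<and> even (k + k mod 2)" for k :: int by presburger
  have mod3: "0 \<le> k mod 3 \<and> k mod 3 \<le> 2 \<and> 3 dvd (k mod 3 - k)" for k :: int by presburger
  show "0 \<le> res3 s \<alpha>" "res3 s \<alpha> \<le> 2" "3 dvd (res3 s \<alpha> - \<alpha> - s)"
    using mod3[of "\<alpha> + s"] unfolding res3_def by (simp_all add: diff_diff_eq)
  show "0 \<le> res2 s \<alpha>" "res2 s \<alpha> \<le> 1" "even (res3 s \<alpha> + res2 s \<alpha> + \<alpha>)"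
    using mod2[of "res3 s \<alpha> + \<alpha>"] unfolding res2_def by (simp_all add: ac_simps)
qed

lemma offset_bounds: "even (offset \<alpha> + \<alpha>)" "3 dvd (offset \<alpha> - \<alpha>)" "- 4 \<le> offset \<alpha>" "offset \<alpha> \<le> 3"
  unfolding offset_def by presburger+

lemma step_layer:
  assumes "even (\<xi> - \<alpha>)"
  shows "\<xi> \<le> 0 \<Longrightarrow> 2 * hstep s \<alpha> \<xi> = 2*s - \<xi> - (res3 s \<alpha> + res2 s \<alpha>)"
    and "\<xi> \<le> 0 \<Longrightarrow> 2 * layer s \<alpha> \<xi> = \<xi> + res2 s \<alpha> - res3 s \<alpha>"
    and "\<xi> > 0 \<Longrightarrow> hstep s \<alpha> \<xi> = 0"
    and "\<xi> > 0 \<Longrightarrow> \<alpha> \<ge> 2 \<Longrightarrow> 2 * layer s \<alpha> \<xi> = \<xi> + \<alpha>"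
    and "\<xi> > 0 \<Longrightarrow> \<alpha> < 2 \<Longrightarrow> 2 * layer s \<alpha> \<xi> = \<xi> + offset \<alpha>"
proof -
  have "even (2*s - \<xi> - (res3 s \<alpha> + res2 s \<alpha>))" "even (\<xi> + (res2 s \<alpha> - res3 s \<alpha>))" "even (\<xi> + \<alpha>)" "even (\<xi> + offset \<alpha>)"
    using assms residue_bounds(5)[of s \<alpha>] offset_bounds(1)[of \<alpha>] by presburger+
  then show "\<xi> \<le> 0 \<Longrightarrow> 2 * hstep s \<alpha> \<xi> = 2*s - \<xi> - (res3 s \<alpha> + res2 s \<alpha>)"
    "\<xi> \<le> 0 \<Longrightarrow> 2 * layer s \<alpha> \<xi> = \<xi> + res2 s \<alpha> - res3 s \<alpha>"
    "\<xi> > 0 \<Longrightarrow> hstep s \<alpha> \<xi> = 0"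
    "\<xi> > 0 \<Longrightarrow> \<alpha> \<ge> 2 \<Longrightarrow> 2 * layer s \<alpha> \<xi> = \<xi> + \<alpha>"
    "\<xi> > 0 \<Longrightarrow> \<alpha> < 2 \<Longrightarrow> 2 * layer s \<alpha> \<xi> = \<xi> + offset \<alpha>"
    by (simp_all add: hstep_def layer_def)
qed

text \<open>The image is a point of the target set, and it is a multiple of the source point. In the stretched part,
this rests on \<open>j = 2 b + res2 s \<alpha>\<close> and \<open>2 i + j = g + a - res3 s \<alpha>\<close>; in the translated part, on
\<open>2 (j - b) = offset \<alpha> - \<alpha>\<close>, where \<open>j - b\<close> is divisible by 3.\<close>

lemma target_arith:
  fixes a b c w n N g N\<^sub>1 s \<alpha> \<xi> p \<zeta> i j :: int
  assumes n: "N = 3 * n" "n \<ge> 0" and abc: "a \<ge> 0" "b \<ge> 0" "c \<ge> 0" "a + 2*b + 3*c = w" "a + b \<le> N"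
    and g: "g = 2*N - w" and N1: "N\<^sub>1 = min N (3 * ((g - 1) div 3))" and s: "s = g - N\<^sub>1"
    and al: "\<alpha> = a - g" and xi: "\<xi> = a + 2*b - N\<^sub>1 + s"
    and p: "p = hstep s \<alpha> \<xi>" and z: "\<zeta> = layer s \<alpha> \<xi>" and i: "i = a + p" and j: "j = N\<^sub>1 + \<zeta> - i"
  shows "s \<ge> 1" "s \<le> 3 \<or> \<xi> \<le> 0" "3 dvd \<xi>" "even (\<xi> - \<alpha>)" "3 dvd N\<^sub>1"
    "a \<le> i" "b \<le> j" "i + j \<le> N" "2*i + j \<ge> g" "3 dvd (w - i - 2*j)" "i + 2*j \<le> a + 2*b + N + 3"
    "\<xi> \<le> 0 \<Longrightarrow> \<zeta> \<le> 0 \<and> \<alpha> < 0" "\<xi> > 0 \<Longrightarrow> \<zeta> > 0" "s = 3 \<Longrightarrow> p \<noteq> 1"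
proof -
  define t where "t = (g - 1) div 3"
  have t: "3*t < g" "g \<le> 3*t + 3" unfolding t_def by presburger+
  have N1': "N\<^sub>1 = 3*t \<and> t \<le> n \<or> N\<^sub>1 = 3*n \<and> n \<le> t" using N1 n unfolding t_def by (auto simp: min_def)
  show d: "3 dvd N\<^sub>1" using N1' by auto
  show s1: "s \<ge> 1" using N1' t s by auto
  show s3: "s \<le> 3 \<or> \<xi> \<le> 0" using N1' t s xi abc g n by auto
  show x3: "3 dvd \<xi>" using xi s g d n(1) abc(4) by presburger
  show ev: "even (\<xi> - \<alpha>)" using xi s al by presburger
  define r e where "r = res3 s \<alpha>" and "e = res2 s \<alpha>"
  note re = residue_bounds[of s \<alpha>, folded r_def e_def]
  note sl = step_layer[OF ev, of s, folded p z, folded r_def e_def]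
  have "(a \<le> i \<and> b \<le> j \<and> i + j \<le> N \<and> 2*i + j \<ge> g \<and> 3 dvd (w - i - 2*j) \<and> i + 2*j \<le> a + 2*b + N + 3) \<and>
    (\<xi> \<le> 0 \<longrightarrow> \<zeta> \<le> 0 \<and> \<alpha> < 0) \<and> (\<xi> > 0 \<longrightarrow> \<zeta> > 0) \<and> (s = 3 \<longrightarrow> p \<noteq> 1)"
  proof (cases "\<xi> \<le> 0")
    case True
    have P: "2*p = 2*s - \<xi> - (r + e)" and Z: "2*\<zeta> = \<xi> + e - r" using sl True by auto
    have jb: "j = 2*b + e" using P Z i j xi by simp
    have p0: "p \<ge> 0" using P re True s1 by presburger
    have z0: "\<zeta> \<le> 0" using Z re True by presburger
    have "r - a = (r - \<alpha> - s) - N\<^sub>1" using al s by simp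
    then have ra: "3 dvd (r - a)" using re(6) d by (metis dvd_diff)
    have ra': "r \<le> a" using ra re(1,2) abc(1) by presburger
    have a1: "\<alpha> < 0" using al xi True s s1 abc by linarith
    have gi: "2*i + j \<ge> g" using P Z i j xi s ra' by simp
    have le: "i + j \<le> N" using j z0 N1 by simp
    have dv: "3 dvd (w - i - 2*j)"
    proof -
      obtain l x d where "r - a = 3*l" "\<xi> = 3*x" "N\<^sub>1 = 3*d" using ra x3 d unfolding dvd_def by blast
      then have "2*(w - i - 2*j) = 3*(2*c - x - 2*d + a + l - e)" using P i jb abc(4) xi by simp
      then have "3 dvd 2*(w - i - 2*j)" by (metis dvd_triv_left)
      then show ?thesis by presburger
    qed
    have top: "i + 2*j \<le> a + 2*b + N + 3"
      using P i jb xi True re N1 abc s by (simp add: min_def split: if_splits)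
    have "s = 3 \<Longrightarrow> p \<noteq> 1" using P re True by presburger
    then show ?thesis using p0 i jb re(3) abc le gi dv top z0 a1 True by auto
  next
    case False
    then have x0: "\<xi> > 0" "\<xi> \<ge> 3" using x3 by presburger+
    have pz: "p = 0" using sl x0 by simp
    have s3': "s \<le> 3" using s3 x0 by auto
    show ?thesis
    proof (cases "\<alpha> \<ge> -2")
      case True
      have Z: "2*\<zeta> = \<xi> + \<alpha>"
      proof (cases "\<alpha> \<ge> 2")
        case False
        then have "offset \<alpha> = \<alpha>" using True unfolding offset_def by presburger
        then show ?thesis using sl x0 False by simp
      qed (use sl x0 in simp)
      have jb: "j = b" using Z j i pz xi al s by simp
      (* For small g, the condition modulo 3 excludes the points near the origin that are too low. *)
      have "2*a + b \<ge> g"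
      proof (cases "g \<ge> 4 \<or> g \<le> 0")
        case False
        then have "g = 1 \<or> g = 2 \<or> g = 3" by auto
        moreover have "3 dvd (a + 2*b + g)"
        proof -
          have "a + 2*b + g = 3*(2*n - c)" using g n abc(4) by simp
          then show ?thesis by simp
        qed
        moreover have "a + 2 \<ge> g" using True al by simp
        ultimately show ?thesis using abc(1,2) by presburger
      qed (use True al abc in auto)
      moreover have "\<zeta> > 0" using Z x0 True by simp
      moreover have "3 dvd (w - a - 2*b)" using abc(4) by presburger
      ultimately show ?thesis using i pz jb abc x0 n by auto
    next
      case False
      then have Z: "2*\<zeta> = \<xi> + offset \<alpha>" using sl x0 by simp
      have jb: "2*(j - b) = offset \<alpha> - \<alpha>" using Z j i pz xi al s by simp
      have q3: "3 dvd (j - b)" using jb offset_bounds(2)[of \<alpha>] by presburger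
      have jb': "b \<le> j" using q3 jb offset_bounds(3)[of \<alpha>] False by presburger
      have lt: "t < n \<or> t = n \<and> N\<^sub>1 = 3*n" "N\<^sub>1 < N"
        using N1' x0 xi s g n abc t by auto
      have N1t: "N\<^sub>1 = 3*t" using N1' lt n by auto
      have gN: "g \<le> N" using t lt N1t n by auto
      have zp: "\<zeta> > 0"
        using Z x0 x3 ev unfolding offset_def by presburger
      have z3: "3 dvd (\<zeta> + \<alpha>)" using Z x3 offset_bounds(2)[of \<alpha>] by presburger
      have "\<xi> \<le> 2*(N - N\<^sub>1)" using xi s g abc by simp
      then have le: "\<zeta> \<le> N - N\<^sub>1"
        using Z x3 ev n(1) N1t unfolding offset_def by presburger
      have gi: "a + N\<^sub>1 + \<zeta> \<ge> g"
        using z3 zp al s s3' abc(1) s1 N1t by presburger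
      have dv: "3 dvd (w - a - 2*j)" using q3 abc(4) by presburger
      have top: "a + 2*j \<le> a + 2*b + N + 3" using jb offset_bounds(4)[of \<alpha>] al gN abc by simp
      show ?thesis using i pz jb' le j gi dv top zp x0 by auto
    qed
  qed
  then show "a \<le> i" "b \<le> j" "i + j \<le> N" "2*i + j \<ge> g" "3 dvd (w - i - 2*j)" "i + 2*j \<le> a + 2*b + N + 3"
    "\<xi> \<le> 0 \<Longrightarrow> \<zeta> \<le> 0 \<and> \<alpha> < 0" "\<xi> > 0 \<Longrightarrow> \<zeta> > 0" "s = 3 \<Longrightarrow> p \<noteq> 1" by blast+
qed

text \<open>The sign of the level tells in which part the source point lies. In the stretched part, \<open>\<xi> - \<alpha>\<close> plus the
second residue is determined by the image; parity then separates the two, and the first residue follows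
in the same way from \<open>3 dvd \<xi>\<close>.\<close>

lemma coords_inj:
  assumes eq: "\<alpha> + hstep s \<alpha> \<xi> = \<alpha>' + hstep s \<alpha>' \<xi>'" "layer s \<alpha> \<xi> = layer s \<alpha>' \<xi>'"
    and xi: "3 dvd \<xi>" "even (\<xi> - \<alpha>)" "3 dvd \<xi>'" "even (\<xi>' - \<alpha>')"
    and neg: "\<xi> \<le> 0 \<Longrightarrow> layer s \<alpha> \<xi> \<le> 0" "\<xi> > 0 \<Longrightarrow> layer s \<alpha> \<xi> > 0"
      "\<xi>' \<le> 0 \<Longrightarrow> layer s \<alpha>' \<xi>' \<le> 0" "\<xi>' > 0 \<Longrightarrow> layer s \<alpha>' \<xi>' > 0"
  shows "\<alpha> = \<alpha>' \<and> \<xi> = \<xi>'"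
proof (cases "\<xi> \<le> 0")
  case True
  then have "\<xi>' \<le> 0" using neg eq by force
  note e = step_layer(1,2)[OF xi(2) True, of s] step_layer(1,2)[OF xi(4) this, of s]
  have "\<xi> - \<alpha> + res2 s \<alpha> = \<xi>' - \<alpha>' + res2 s \<alpha>'" using e eq by linarith
  then have ed: "\<xi> - \<alpha> = \<xi>' - \<alpha>'" "res2 s \<alpha> = res2 s \<alpha>'"
    using xi(2,4) residue_bounds(3,4)[of s \<alpha>] residue_bounds(3,4)[of s \<alpha>'] by presburger+
  then have "\<xi> - res3 s \<alpha> = \<xi>' - res3 s \<alpha>'" using e(2,4) eq(2) by linarith
  then have "\<xi> = \<xi>'" using xi(1,3) residue_bounds(1,2)[of s \<alpha>] residue_bounds(1,2)[of s \<alpha>'] by presburger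
  then show ?thesis using ed by simp
next
  case False
  then have x: "\<xi> > 0" "\<xi>' > 0" using neg eq by force+
  then have a: "\<alpha> = \<alpha>'" using eq by (simp add: hstep_def)
  have "2 * layer s \<alpha> \<xi> - \<xi> = 2 * layer s \<alpha> \<xi>' - \<xi>'"
    using step_layer(4,5)[OF xi(2) x(1), of s] step_layer(4,5)[OF xi(4)[folded a] x(2), of s] by (cases "\<alpha> \<ge> 2") simp_all
  then show ?thesis using a eq(2) by simp
qed

section \<open>The cost of an edge\<close>

text \<open>The cost of a pair is \<open>x (x + 3) + 2 y (y + 1)\<close> up to potentials. The linear terms put the centre of the
quadratic form into the middle of the rounding errors \<open>-3 \<le> x \<le> 0\<close> and \<open>-2 \<le> y \<le> 1\<close> of the stretched part.\<close>

text \<open>A potential on the target points and, in the cost, a correction term that depends on the multiplier. The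
slopes \<open>\<plusminus> 4\<close> in \<open>z\<close> are forced: they make the outliers \<open>-4\<close> and \<open>3\<close> of \<open>offset\<close> exactly as cheap as \<open>2\<close> and \<open>-3\<close>.
The constants are one solution of the system of linear inequalities which says that the matching is
nowhere more expensive than an alternative and that the slides are the only ties.\<close>

definition pot :: "int \<Rightarrow> int \<Rightarrow> int \<Rightarrow> int" where
  "pot s t z = (if z \<le> 0 then (if s = 2 \<and> t mod 6 = 3 then 2 else 0)
     else (if t mod 6 = 2 then 4 * z else if t mod 6 = 3 then - 4 * z else 0) +
       (if s = 1 then (if t mod 6 = 1 then - 1 else if t mod 6 = 2 then - 14 else 0)
        else if s = 2 then (if t mod 6 = 1 then - 15 else if t mod 6 = 2 then - 20
           else if t mod 6 = 3 then 2 else if t mod 6 = 4 then 5 else 0)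
        else if s = 3 then (if t mod 6 = 2 then - 4 else if t mod 6 = 3 then - 9 else 0)
        else 0))"

definition cost :: "int \<Rightarrow> int \<Rightarrow> int \<Rightarrow> int \<Rightarrow> int \<Rightarrow> int" where
  "cost s \<alpha> \<xi> p \<zeta> = (\<xi> - 2*s + 2*p) * (\<xi> - 2*s + 2*p + 3) + 2 * (2*\<zeta> - \<xi>) * (2*\<zeta> - \<xi> + 1)
     + pot s (\<alpha> + p) \<zeta> + (if s = 2 \<and> p mod 6 = 2 then 7 else 0)"

text \<open>The mixed terms of the cost in source and multiplier combine to \<open>12 a p + 8 (b p + a q)\<close>. Both parts split, as
\<open>2 a p = i\<^sup>2 - a\<^sup>2 - p\<^sup>2\<close> and \<open>b p + a q = i j - a b - p q\<close>. This dictates the ratio of the two squares.\<close>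

lemma cost_splits:
  fixes a b i j g N\<^sub>1 s p q :: int
  assumes "s = g - N\<^sub>1" "p = i - a" "q = j - b"
  shows "cost s (a - g) (a + 2*b - N\<^sub>1 + s) p (i + j - N\<^sub>1) =
    ((a + 2*b - g) * (a + 2*b - g + 3) + 2 * (a - g) * (a - g + 1) - 6*a*a - 8*a*b)
    + (6*i*i + 8*i*j + pot s (i - g) (i + j - N\<^sub>1))
    + (4*p*p + 6*p - 4*g*p + 8*(p+q)*(p+q) + 4*(p+q) - 8*g*(p+q) - 6*p*p - 8*p*q + (if s = 2 \<and> p mod 6 = 2 then 7 else 0))"
proof -
  have e: "a + 2*b - N\<^sub>1 + s - 2*s + 2*p = a + 2*b - g + 2*p" "2*(i + j - N\<^sub>1) - (a + 2*b - N\<^sub>1 + s) = a - g + 2*p + 2*q"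
    "a - g + p = i - g" "i = a + p" "j = b + q"
    using assms by simp_all
  show ?thesis unfolding cost_def e(1-3) unfolding e(4,5) by (simp add: algebra_simps)
qed

section \<open>The matching chooses cheapest edges\<close>

lemma int_le_square: fixes k :: int shows "k \<le> k*k" "-k \<le> k*k"
proof -
  have "0 \<le> k * (k - 1)" by (cases "k \<le> 0") (auto intro: mult_nonpos_nonpos mult_nonneg_nonneg)
  moreover have "0 \<le> k * (k + 1)" by (cases "k \<le> -1") (auto intro: mult_nonpos_nonpos mult_nonneg_nonneg)
  ultimately show "k \<le> k*k" "-k \<le> k*k" by (auto simp: algebra_simps)
qed

lemma int_le_square_below: fixes k :: int shows "- 3*k - 2 \<le> k*k"
proof -
  have "0 \<le> (k + 2) * (k + 1)" by (cases "k \<le> -2") (auto intro: mult_nonpos_nonpos mult_nonneg_nonneg)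
  then show ?thesis by (auto simp: algebra_simps)
qed

lemma le_of_times_add_three:
  fixes x :: int
  assumes "x * (x + 3) \<le> 11" shows "-5 \<le> x" "x \<le> 2"
proof -
  show "-5 \<le> x"
  proof (rule ccontr)
    assume "\<not> ?thesis" then have "0 \<le> (-6 - x) * (3 - x)" by (intro mult_nonneg_nonneg) auto
    then show False using assms \<open>\<not> _\<close> by (simp add: algebra_simps)
  qed
  show "x \<le> 2"
  proof (rule ccontr)
    assume "\<not> ?thesis" then have "0 \<le> (x - 3) * (x + 6)" by (intro mult_nonneg_nonneg) auto
    then show False using assms \<open>\<not> _\<close> by (simp add: algebra_simps)
  qed
qed

lemma le_of_two_times_consecutive:
  fixes y :: int
  assumes "2 * y * (y + 1) \<le> 13" shows "-3 \<le> y" "y \<le> 2"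
proof -
  show "-3 \<le> y"
  proof (rule ccontr)
    assume "\<not> ?thesis" then have "0 \<le> (-4 - y) * (3 - y)" by (intro mult_nonneg_nonneg) auto
    then show False using assms \<open>\<not> _\<close> by (simp add: algebra_simps)
  qed
  show "y \<le> 2"
  proof (rule ccontr)
    assume "\<not> ?thesis" then have "0 \<le> (y - 3) * (y + 4)" by (intro mult_nonneg_nonneg) auto
    then show False using assms \<open>\<not> _\<close> by (simp add: algebra_simps)
  qed
qed

text \<open>Within the stretched part the cost of the matching is at most 2 up to the corrections, so a competitor
has \<open>-5 \<le> x \<le> 2\<close> and \<open>-3 \<le> y \<le> 2\<close>. As \<open>x\<close> and \<open>y\<close> are prescribed modulo 2 and \<open>x + y\<close> is
prescribed modulo 3, finitely many cases remain.\<close>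

lemma cost_bottom_bottom:
  fixes s \<alpha> \<xi> p \<zeta> p\<^sub>0 \<zeta>\<^sub>0 :: int
  assumes xi: "3 dvd \<xi>" "even (\<xi> - \<alpha>)" and z: "\<zeta> \<le> 0" "3 dvd (\<zeta> + \<alpha> + p)"
    and p0: "2*p\<^sub>0 = 2*s - \<xi> - (res3 s \<alpha> + res2 s \<alpha>)" "2*\<zeta>\<^sub>0 = \<xi> + res2 s \<alpha> - res3 s \<alpha>" and z0: "\<zeta>\<^sub>0 \<le> 0"
    and le: "cost s \<alpha> \<xi> p \<zeta> \<le> cost s \<alpha> \<xi> p\<^sub>0 \<zeta>\<^sub>0"
  shows "p = p\<^sub>0 \<and> \<zeta> = \<zeta>\<^sub>0"
proof -
  define x where "x = \<xi> - 2*s + 2*p"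
  define y where "y = 2*\<zeta> - \<xi>"
  define r where "r = \<alpha> mod 6"
  define i where "i = p mod 6"
  define \<rho> where "\<rho> = res3 s \<alpha>"
  define \<epsilon> where "\<epsilon> = res2 s \<alpha>"
  have re: "\<rho> = 0 \<or> \<rho> = 1 \<or> \<rho> = 2" "\<epsilon> = 0 \<or> \<epsilon> = 1" using residue_bounds(1-4)[of s \<alpha>] unfolding \<rho>_def \<epsilon>_def by linarith+
  have x0: "\<xi> - 2*s + 2*p\<^sub>0 = - (\<rho> + \<epsilon>)" "2*\<zeta>\<^sub>0 - \<xi> = \<epsilon> - \<rho>" using p0 by (simp_all add: \<rho>_def \<epsilon>_def)
  define k k\<^sub>0 where "k = (if s = 2 \<and> (\<alpha> + p) mod 6 = 3 then 2 else 0 :: int) + (if s = 2 \<and> p mod 6 = 2 then 7 else 0)"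
    and "k\<^sub>0 = (if s = 2 \<and> (\<alpha> + p\<^sub>0) mod 6 = 3 then 2 else 0 :: int) + (if s = 2 \<and> p\<^sub>0 mod 6 = 2 then 7 else 0)"
  have D: "x*(x+3) + 2*y*(y+1) + k \<le> (\<rho>+\<epsilon>)*(\<rho>+\<epsilon>-3) + 2*(\<epsilon>-\<rho>)*(\<epsilon>-\<rho>+1) + k\<^sub>0"
    using le z z0 unfolding cost_def x_def[symmetric] y_def[symmetric] x0 pot_def k_def k\<^sub>0_def
    by (simp add: algebra_simps)
  have e2: "(\<rho>+\<epsilon>)*(\<rho>+\<epsilon>-3) + 2*(\<epsilon>-\<rho>)*(\<epsilon>-\<rho>+1) \<le> 2" using re by (elim disjE) simp_all
  have m: "3 dvd (x + y - \<rho>)" "even (x - \<rho> - \<epsilon>)" "even (y - \<rho> - \<epsilon>)"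
  proof -
    obtain k l h h' where k: "\<zeta> + \<alpha> + p = 3*k" and l: "\<rho> - \<alpha> - s = 3*l" and h: "\<xi> - \<alpha> = 2*h" and h': "\<rho> + \<epsilon> + \<alpha> = 2*h'"
      using z(2) xi(2) residue_bounds(5,6)[of s \<alpha>, folded \<rho>_def \<epsilon>_def] unfolding dvd_def by auto
    have "x + y - \<rho> = 3*(2*k - l - \<alpha> - s)" "x - \<rho> - \<epsilon> = 2*(h - s + p - h' + \<alpha>)" "y - \<rho> - \<epsilon> = 2*(\<zeta> - h - h')"
      using k l h h' by (simp_all add: x_def y_def)
    then show "3 dvd (x + y - \<rho>)" "even (x - \<rho> - \<epsilon>)" "even (y - \<rho> - \<epsilon>)" by (metis dvd_triv_left)+
  qed
  have nn: "x*(x+3) \<ge> -2" "2*y*(y+1) \<ge> 0" using int_le_square_below[of x] int_le_square(2)[of y] by (simp_all add: algebra_simps)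
  have kb: "k \<ge> 0" "k\<^sub>0 \<le> 9" "s \<noteq> 2 \<Longrightarrow> k = 0 \<and> k\<^sub>0 = 0" by (auto simp: k_def k\<^sub>0_def)
  have bx: "-5 \<le> x" "x \<le> 2" using le_of_times_add_three[of x] D e2 nn kb by linarith+
  have by': "-3 \<le> y" "y \<le> 2" using le_of_two_times_consecutive[of y] D e2 nn kb by linarith+
  have X: "x = -5 \<or> x = -4 \<or> x = -3 \<or> x = -2 \<or> x = -1 \<or> x = 0 \<or> x = 1 \<or> x = 2" using bx by presburger
  have Y: "y = -3 \<or> y = -2 \<or> y = -1 \<or> y = 0 \<or> y = 1 \<or> y = 2" using by' by presburger
  have "x = - (\<rho> + \<epsilon>) \<and> y = \<epsilon> - \<rho>"
  proof (cases "s = 2")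
    case False
    then have "x*(x+3) + 2*y*(y+1) \<le> (\<rho>+\<epsilon>)*(\<rho>+\<epsilon>-3) + 2*(\<epsilon>-\<rho>)*(\<epsilon>-\<rho>+1)" using D kb by simp
    then show ?thesis using X Y re m by (elim disjE) simp_all
  next
    case True
    have r: "r = 0 \<or> r = 1 \<or> r = 2 \<or> r = 3 \<or> r = 4 \<or> r = 5" unfolding r_def by presburger
    have i: "i = 0 \<or> i = 1 \<or> i = 2 \<or> i = 3 \<or> i = 4 \<or> i = 5" unfolding i_def by presburger
    have rho: "\<rho> = (r + 2) mod 3" "\<epsilon> = (\<rho> + r) mod 2"
    proof -
      have c: "\<alpha> mod 6 mod 3 = \<alpha> mod 3" "\<alpha> mod 6 mod 2 = \<alpha> mod 2" by (simp_all add: mod_mod_cancel)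
      show "\<rho> = (r + 2) mod 3" unfolding \<rho>_def res3_def r_def True by (metis c(1) mod_add_left_eq)
      show "\<epsilon> = (\<rho> + r) mod 2" unfolding \<epsilon>_def res2_def \<rho>_def r_def by (metis c(2) mod_add_right_eq)
    qed
    have mi: "3 dvd (x + i - 2)"
    proof -
      obtain k where "\<xi> = 3*k" using xi(1) unfolding dvd_def by auto
      then have "x + i - 2 = 3*(k + p - 2 - 2*(p div 6))"
        using True minus_mult_div_eq_mod[of p 6] by (simp add: x_def i_def)
      then show ?thesis by (metis dvd_triv_left)
    qed
    have pp: "2*p\<^sub>0 = 2*p - x - (\<rho> + \<epsilon>)" using x0 by (simp add: x_def)
    have t: "(\<alpha> + p) mod 6 = (r + i) mod 6" by (simp add: r_def i_def mod_simps)
    have k: "k = (if (r + i) mod 6 = 3 then 2 else 0) + (if i = 2 then 7 else 0)" using True t by (simp add: k_def i_def)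
    define h where "h = (x + \<rho> + \<epsilon>) div 2"
    have h: "p\<^sub>0 = p - h" using pp m(2) by (simp add: h_def)
    have k0: "k\<^sub>0 = (if (r + i - h) mod 6 = 3 then 2 else 0) + (if (i - h) mod 6 = 2 then 7 else 0)"
    proof -
      have "(\<alpha> + p\<^sub>0) mod 6 = (r + i - h) mod 6" unfolding h add_diff_eq by (metis t mod_diff_left_eq)
      moreover have "p\<^sub>0 mod 6 = (i - h) mod 6" unfolding h i_def by (simp add: mod_diff_left_eq)
      ultimately show ?thesis using True by (simp add: k\<^sub>0_def)
    qed
    show ?thesis using D[unfolded k k0 h_def rho] m[unfolded rho] mi unfolding rho
      by (insert X Y r i, elim disjE) simp_all
  qed
  then have "x = - (\<rho> + \<epsilon>)" "y = \<epsilon> - \<rho>" by blast+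
  then have "p = p\<^sub>0" "\<zeta> = \<zeta>\<^sub>0" using x0 unfolding x_def y_def by linarith+
  then show ?thesis by (rule conjI)
qed

text \<open>A pair from the stretched part to a positive level has \<open>y \<ge> 2 \<zeta>\<close> and is too expensive except at the very
interface, where \<open>\<xi> = 0\<close> and \<open>\<zeta> = 1\<close>; then \<open>p\<close> is bounded, too.\<close>

lemma cost_bottom_top:
  fixes s \<alpha> \<xi> p \<zeta> p\<^sub>0 \<zeta>\<^sub>0 :: int
  assumes s: "s = 1 \<or> s = 2 \<or> s = 3" and xi: "\<xi> \<le> 0" "3 dvd \<xi>" "even (\<xi> - \<alpha>)"
    and z: "\<zeta> > 0" "3 dvd (\<zeta> + \<alpha> + p)" and p: "p \<ge> 0" "s = 3 \<Longrightarrow> p \<noteq> 1"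
    and p0: "2*p\<^sub>0 = 2*s - \<xi> - (res3 s \<alpha> + res2 s \<alpha>)" "2*\<zeta>\<^sub>0 = \<xi> + res2 s \<alpha> - res3 s \<alpha>" and z0: "\<zeta>\<^sub>0 \<le> 0"
    and le: "cost s \<alpha> \<xi> p \<zeta> \<le> cost s \<alpha> \<xi> p\<^sub>0 \<zeta>\<^sub>0"
  shows "\<alpha> mod 6 = 2 \<and> \<xi> = 0 \<and> p = 0 \<and> \<zeta> = 1"
proof -
  define x where "x = \<xi> - 2*s + 2*p"
  define y where "y = 2*\<zeta> - \<xi>"
  define r where "r = \<alpha> mod 6"
  define \<rho> where "\<rho> = res3 s \<alpha>"
  define \<epsilon> where "\<epsilon> = res2 s \<alpha>"
  have re: "\<rho> = 0 \<or> \<rho> = 1 \<or> \<rho> = 2" "\<epsilon> = 0 \<or> \<epsilon> = 1" using residue_bounds(1-4)[of s \<alpha>] unfolding \<rho>_def \<epsilon>_def by linarith+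
  have x0: "\<xi> - 2*s + 2*p\<^sub>0 = - (\<rho> + \<epsilon>)" "2*\<zeta>\<^sub>0 - \<xi> = \<epsilon> - \<rho>" using p0 by (simp_all add: \<rho>_def \<epsilon>_def)
  have e2: "(\<rho>+\<epsilon>)*(\<rho>+\<epsilon>-3) + 2*(\<epsilon>-\<rho>)*(\<epsilon>-\<rho>+1) \<le> 2" using re by (elim disjE) simp_all
  define c\<^sub>0 where "c\<^sub>0 = (\<rho>+\<epsilon>)*(\<rho>+\<epsilon>-3) + 2*(\<epsilon>-\<rho>)*(\<epsilon>-\<rho>+1) + pot s (\<alpha> + p\<^sub>0) \<zeta>\<^sub>0
    + (if s = 2 \<and> p\<^sub>0 mod 6 = 2 then 7 else 0)"
  have c0: "c\<^sub>0 \<le> 11" using e2 z0 by (auto simp: c\<^sub>0_def pot_def)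
  have D: "x*(x+3) + 2*y*(y+1) + pot s (\<alpha>+p) \<zeta> + (if s = 2 \<and> p mod 6 = 2 then 7 else 0) \<le> c\<^sub>0"
    using le unfolding cost_def x_def[symmetric] y_def[symmetric] x0 c\<^sub>0_def by (simp add: algebra_simps)
  then have D': "x*(x+3) + 2*y*(y+1) + pot s (\<alpha>+p) \<zeta> \<le> 11" using c0 by (auto split: if_splits)
  have nn: "x*(x+3) \<ge> -2" using int_le_square_below[of x] by (simp add: algebra_simps)
  have pt: "pot s (\<alpha>+p) \<zeta> \<ge> - 4*\<zeta> - 12" using z s by (auto simp: pot_def)
  have y2: "y \<ge> 2*\<zeta>" "y \<ge> 2" using xi z by (auto simp: y_def)
  have "y \<le> 3"
  proof (rule ccontr)
    assume "\<not> ?thesis"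
    then have "0 \<le> (y - 4)*(2*y + 8)" by (intro mult_nonneg_nonneg) auto
    then have "2*y*(y+1) \<ge> 32 + 2*y" by (simp add: algebra_simps)
    then show False using D' nn pt y2 \<open>\<not> _\<close> by linarith
  qed
  then have zx: "\<zeta> = 1" "\<xi> = 0" "y = 2" using z xi unfolding y_def by presburger+
  have tm: "(\<alpha> + p) mod 6 = 2 \<or> (\<alpha> + p) mod 6 = 5" using z(2) zx by presburger
  have "x*(x+3) \<le> 15" using D' zx tm s by (auto simp: pot_def)
  then have px: "p \<le> s + 1"
  proof (rule contrapos_pp)
    assume "\<not> p \<le> s + 1"
    then have "0 \<le> (x - 4)*(x+7)" using zx by (intro mult_nonneg_nonneg) (auto simp: x_def)
    then show "\<not> x*(x+3) \<le> 15" by (simp add: algebra_simps)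
  qed
  have r: "r = 0 \<or> r = 2 \<or> r = 4" using xi(3) zx unfolding r_def by presburger
  have pc: "p = 0 \<or> p = 1 \<or> p = 2 \<or> p = 3 \<or> p = 4" using px p s by auto
  have rho: "\<rho> = (r + s) mod 3" "\<epsilon> = (\<rho> + r) mod 2"
    proof -
      have c: "\<alpha> mod 6 mod 3 = \<alpha> mod 3" "\<alpha> mod 6 mod 2 = \<alpha> mod 2" by (simp_all add: mod_mod_cancel)
      show "\<rho> = (r + s) mod 3" unfolding \<rho>_def res3_def r_def by (metis c(1) mod_add_left_eq)
      show "\<epsilon> = (\<rho> + r) mod 2" unfolding \<epsilon>_def res2_def \<rho>_def r_def by (metis c(2) mod_add_right_eq)
    qed
  have pp: "p\<^sub>0 = s - (\<rho> + \<epsilon>) div 2" using x0 zx by simp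
  have pm: "pot s (\<alpha> + p\<^sub>0) \<zeta>\<^sub>0 = (if s = 2 \<and> (r + p\<^sub>0) mod 6 = 3 then 2 else 0)"
    "pot s (\<alpha> + p) 1 = pot s (r + p) 1"
    using z0 zx by (simp_all add: pot_def r_def mod_simps)
  have t: "(r + p) mod 6 = 2 \<or> (r + p) mod 6 = 5" using tm by (simp add: r_def mod_simps)
  have tab: "(s = 1 \<and> r = 0 \<and> \<rho> = 1 \<and> \<epsilon> = 1) \<or> (s = 1 \<and> r = 2 \<and> \<rho> = 0 \<and> \<epsilon> = 0) \<or> (s = 1 \<and> r = 4 \<and> \<rho> = 2 \<and> \<epsilon> = 0)
    \<or> (s = 2 \<and> r = 0 \<and> \<rho> = 2 \<and> \<epsilon> = 0) \<or> (s = 2 \<and> r = 2 \<and> \<rho> = 1 \<and> \<epsilon> = 1) \<or> (s = 2 \<and> r = 4 \<and> \<rho> = 0 \<and> \<epsilon> = 0)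
    \<or> (s = 3 \<and> r = 0 \<and> \<rho> = 0 \<and> \<epsilon> = 0) \<or> (s = 3 \<and> r = 2 \<and> \<rho> = 2 \<and> \<epsilon> = 0) \<or> (s = 3 \<and> r = 4 \<and> \<rho> = 1 \<and> \<epsilon> = 1)"
    using s r by (elim disjE) (simp_all add: rho)
  have xe: "x = 2*p - 2*s" using zx by (simp add: x_def)
  have D2: "(2*p - 2*s)*(2*p - 2*s + 3) + 2*2*(2+1) + pot s (r + p) 1 + (if s = 2 \<and> p mod 6 = 2 then 7 else 0)
     \<le> (\<rho>+\<epsilon>)*(\<rho>+\<epsilon>-3) + 2*(\<epsilon>-\<rho>)*(\<epsilon>-\<rho>+1) + (if s = 2 \<and> (r + p\<^sub>0) mod 6 = 3 then 2 else 0)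
       + (if s = 2 \<and> p\<^sub>0 mod 6 = 2 then 7 else 0)"
    using D unfolding c\<^sub>0_def xe zx pm .
  have "r = 2 \<and> p = 0"
    using tab pc
  proof (elim disjE conjE, goal_cases)
    case (1) then show ?case using D2 pp t p(2) by (simp add: pot_def)
  qed (use D2 pp t p(2) in \<open>simp_all add: pot_def\<close>)
  then show ?thesis using zx by (simp add: r_def)
qed

text \<open>For a fixed class of \<open>\<alpha>\<close> and \<open>p\<close> modulo 6 also \<open>y\<close> is fixed modulo 6. With \<open>p = 6 n + i\<close> and
\<open>y = 6 l + c\<close>, the difference of the costs becomes a positive quadratic form in \<open>n\<close> and \<open>l\<close> with no mixed
term, plus linear terms and a multiple of \<open>n \<xi>\<close>. It suffices to know \<open>k\<^sup>2 \<ge> \<bar>k\<bar>\<close> and \<open>k\<^sup>2 \<ge> - 3 k - 2\<close> for integers.\<close>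

lemma cost_top_top:
  fixes s \<alpha> \<xi> p \<zeta> :: int
  assumes s: "s = 1 \<or> s = 2 \<or> s = 3" and xi: "\<xi> > 0" "3 dvd \<xi>" "even (\<xi> - \<alpha>)"
    and z: "\<zeta> > 0" "3 dvd (\<zeta> + \<alpha> + p)" and p: "p \<ge> 0" "s = 3 \<Longrightarrow> p \<noteq> 1" and pz: "2*\<zeta>\<^sub>0 = \<xi> + offset \<alpha>" "\<zeta>\<^sub>0 > 0"
    and le: "cost s \<alpha> \<xi> p \<zeta> \<le> cost s \<alpha> \<xi> 0 \<zeta>\<^sub>0"
  shows "p = 0 \<and> \<zeta> = \<zeta>\<^sub>0 \<or> \<alpha> mod 6 = 2 \<and> p = 0 \<and> 2*\<zeta> = \<xi> + 2 \<or> \<alpha> mod 6 = 2 \<and> p = 1 \<and> 2*\<zeta> = \<xi>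
    \<or> \<alpha> mod 6 = 3 \<and> p = 0 \<and> 2*\<zeta> = \<xi> - 3"
proof -
  define n i where "n = p div 6" and "i = p mod 6"
  have pn: "p = 6*n + i" "0 \<le> n" "0 \<le> i" "i < 6" using p by (auto simp: n_def i_def)
  define A r where "A = \<alpha> div 6" and "r = \<alpha> mod 6"
  have ar: "\<alpha> = 6*A + r" "0 \<le> r" "r < 6" by (auto simp: A_def r_def)
  define y where "y = 2*\<zeta> - \<xi>"
  (* c is determined by its residues r modulo 2 and r + i modulo 3. *)
  define c where "c = (if even r then (4*(r+i)) mod 6 else (4*(r+i)+3) mod 6)"
  have yc: "y mod 6 = c" 
  proof -
    obtain k x h where k: "\<zeta> + \<alpha> + p = 3*k" and x: "\<xi> = 3*x" and h: "\<xi> - \<alpha> = 2*h"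
      using xi z(2) unfolding dvd_def by auto
    have "y - r = 2*(\<zeta> - h - 3*A - r)" "y - r - i = 3*(2*k - 4*A - 4*n - x - r - i)"
      using k x h ar(1) pn(1) by (simp_all add: y_def)
    then have "even (y - r)" "3 dvd (y - r - i)" by (metis dvd_triv_left)+
    moreover have "r = 0 \<or> r = 1 \<or> r = 2 \<or> r = 3 \<or> r = 4 \<or> r = 5" "i = 0 \<or> i = 1 \<or> i = 2 \<or> i = 3 \<or> i = 4 \<or> i = 5"
      using ar pn by auto
    then have "even (c - r) \<and> 3 dvd (c - r - i) \<and> 0 \<le> c \<and> c < 6"
      by (elim disjE) (simp_all add: c_def)
    ultimately have "even (y - c)" "3 dvd (y - c)" "0 \<le> c" "c < 6" by presburger+
    then show ?thesis by presburger
  qed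
  define l where "l = y div 6"
  have yl: "y = 6*l + c" using yc by (auto simp: l_def)
  have zz: "2*\<zeta> = \<xi> + y" by (simp add: y_def)
  have r: "r = 0 \<or> r = 1 \<or> r = 2 \<or> r = 3 \<or> r = 4 \<or> r = 5" using ar by auto
  have i: "i = 0 \<or> i = 1 \<or> i = 2 \<or> i = 3 \<or> i = 4 \<or> i = 5" using pn by auto
  have t: "(\<alpha> + p) mod 6 = (r + i) mod 6" unfolding r_def i_def by (simp add: mod_add_eq)
  have nn: "n = 0 \<or> n \<ge> 1" using pn by auto
  have ll: "l = 0 \<or> l \<ge> 1 \<or> l \<le> -1" by auto
  have sq: "n*n \<ge> n" "l*l \<ge> l" "l*l \<ge> - l" using int_le_square by blast+
  have xi3: "\<xi> \<ge> 3" "even r \<Longrightarrow> \<xi> \<ge> 6" using xi ar(1) by presburger+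
  have nx: "n*\<xi> \<ge> 3*n" using mult_left_mono[OF xi3(1) pn(2)] by (simp add: mult.commute)
  have y0: "2*\<zeta>\<^sub>0 - \<xi> = offset \<alpha>" using pz(1) by simp
  have D: "2*p*(2*\<xi> - 4*s + 2*p + 3) + 2*y*(y+1) - 2*offset \<alpha>*(offset \<alpha>+1) + pot s (\<alpha>+p) \<zeta> - pot s \<alpha> \<zeta>\<^sub>0
     + (if s = 2 \<and> p mod 6 = 2 then 7 else 0) \<le> 0"
    using le unfolding cost_def y0 y_def[symmetric] by (simp add: algebra_simps)
  have pm: "pot s (\<alpha>+p) \<zeta> = pot s (r+i) \<zeta>" "pot s \<alpha> \<zeta>\<^sub>0 = pot s r \<zeta>\<^sub>0" "offset \<alpha> = offset r"
  proof -
    have t': "\<alpha> mod 6 = r mod 6" by (simp add: r_def)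
    show "pot s (\<alpha>+p) \<zeta> = pot s (r+i) \<zeta>" unfolding pot_def t ..
    show "pot s \<alpha> \<zeta>\<^sub>0 = pot s r \<zeta>\<^sub>0" "offset \<alpha> = offset r" unfolding pot_def offset_def t' by (rule refl)+
  qed
  (* Once the products are replaced by variables, every case is linear. *)
  obtain NN NX LL where at: "NN = n*n" "NX = n*\<xi>" "LL = l*l" by blast
  have D2: "24*NX + 4*i*\<xi> - 48*s*n - 8*s*i + 144*NN + 48*i*n + 4*i*i + 36*n + 6*i + 72*LL + 24*c*l + 2*c*c + 12*l + 2*c
     - 2*offset r*(offset r+1) + pot s (r+i) \<zeta> - pot s r \<zeta>\<^sub>0
     + (if s = 2 \<and> i = 2 then 7 else 0) \<le> 0" using D unfolding yl pm i_def[symmetric] unfolding pn(1) at by (simp add: algebra_simps)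
  have zz: "2*\<zeta> = \<xi> + 6*l + c" "2*\<zeta>\<^sub>0 = \<xi> + offset r" using zz yl pz pm by simp_all
  have sq': "NN \<ge> n" "LL \<ge> l" "LL \<ge> -l" "LL \<ge> -3*l-2" "NX \<ge> 3*n" "l = 0 \<Longrightarrow> LL = 0" "n = 0 \<Longrightarrow> NN = 0" "n = 0 \<Longrightarrow> NX = 0" using sq nx at int_le_square_below[of l] by simp_all
  have p1: "s = 3 \<Longrightarrow> 6*n+i \<noteq> 1" using p pn(1) by simp
  have "6*n+i = 0 \<and> \<zeta> = \<zeta>\<^sub>0 \<or> r = 2 \<and> 6*n+i = 0 \<and> 2*\<zeta> = \<xi> + 2 \<or> r = 2 \<and> 6*n+i = 1 \<and> 2*\<zeta> = \<xi>
    \<or> r = 3 \<and> 6*n+i = 0 \<and> 2*\<zeta> = \<xi> - 3"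
   using s r i nn ll D2 z(1) pz(2) zz p1 sq' xi3 unfolding c_def
   apply (elim disjE)
   apply (simp_all add: pot_def offset_def)
   done
  then show ?thesis using pn(1) r_def by simp
qed

text \<open>Here \<open>y \<le> - \<xi>\<close>, and the cost grows quadratically with \<open>\<xi>\<close> while the matching gains only linearly, which
leaves \<open>\<xi> = 3\<close>.\<close>

lemma cost_top_bottom:
  fixes s \<alpha> \<xi> p \<zeta> \<zeta>\<^sub>0 :: int
  assumes s: "s = 1 \<or> s = 2 \<or> s = 3" and xi: "\<xi> > 0" "3 dvd \<xi>" "even (\<xi> - \<alpha>)"
    and z: "\<zeta> \<le> 0" "3 dvd (\<zeta> + \<alpha> + p)" and p: "p \<ge> 0" "s = 3 \<Longrightarrow> p \<noteq> 1" and pz: "2*\<zeta>\<^sub>0 = \<xi> + offset \<alpha>" "\<zeta>\<^sub>0 > 0"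
    and le: "cost s \<alpha> \<xi> p \<zeta> \<le> cost s \<alpha> \<xi> 0 \<zeta>\<^sub>0"
  shows "\<alpha> mod 6 = 3 \<and> p = 0 \<and> 2*\<zeta> = \<xi> - 3"
proof -
  define y where "y = 2*\<zeta> - \<xi>"
  have y0: "2*\<zeta>\<^sub>0 - \<xi> = offset \<alpha>" using pz(1) by simp
  have D: "2*p*(2*\<xi> - 4*s + 2*p + 3) + 2*y*(y+1) - 2*offset \<alpha>*(offset \<alpha>+1) + pot s (\<alpha>+p) \<zeta> - pot s \<alpha> \<zeta>\<^sub>0
     + (if s = 2 \<and> p mod 6 = 2 then 7 else 0) \<le> 0"
    using le unfolding cost_def y0 y_def[symmetric] by (simp add: algebra_simps)
  have xi3: "\<xi> \<ge> 3" "even \<alpha> \<Longrightarrow> \<xi> \<ge> 6" using xi by presburger+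
  have pt: "p = 0 \<or> 2*p*(2*\<xi> - 4*s + 2*p + 3) \<ge> 4"
  proof (cases "p = 0")
    case False
    have "2*\<xi> - 4*s + 2*p + 3 \<ge> 1" using False s xi3(1) p by auto
    then have "2*p*(2*\<xi> - 4*s + 2*p + 3) \<ge> 2*p*1" using p(1) by (intro mult_left_mono) auto
    moreover have "p = 1 \<Longrightarrow> 2*\<xi> - 4*s + 2*p + 3 \<ge> 3" using s xi3(1) p by auto
    ultimately show ?thesis using False p(1) by (cases "p = 1") (simp, linarith)
  qed simp
  define PT where "PT = 2*p*(2*\<xi> - 4*s + 2*p + 3)"
  have pt: "PT \<ge> 0" "p \<noteq> 0 \<Longrightarrow> PT \<ge> 4" using pt by (auto simp: PT_def)
  define Y2 where "Y2 = 2*y*(y+1)"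
  define YS where "YS = 2*offset \<alpha>*(offset \<alpha>+1)"
  have D: "PT + Y2 - YS + pot s (\<alpha>+p) \<zeta> - pot s \<alpha> \<zeta>\<^sub>0 \<le> 0"
    using D unfolding PT_def Y2_def YS_def by (auto split: if_splits)
  have ny: "y \<le> - \<xi>" using z by (simp add: y_def)
  have y2: "Y2 \<ge> 2*\<xi>*(\<xi>-1)"
  proof -
    have "0 \<le> (- \<xi> - y)*(\<xi> - 1 - y)" using ny xi3 by (intro mult_nonneg_nonneg) auto
    then show ?thesis by (simp add: Y2_def algebra_simps)
  qed
  have pm: "pot s (\<alpha>+p) \<zeta> \<ge> 0" using z by (simp add: pot_def)
  have r: "\<alpha> mod 6 = 0 \<or> \<alpha> mod 6 = 1 \<or> \<alpha> mod 6 = 2 \<or> \<alpha> mod 6 = 3 \<or> \<alpha> mod 6 = 4 \<or> \<alpha> mod 6 = 5" by presburger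
  have x3: "\<xi> = 3"
  proof (rule ccontr)
    assume "\<xi> \<noteq> 3"
    then have x6: "\<xi> \<ge> 6" using xi by presburger
    have "2*\<xi>*(\<xi>-1) \<ge> 2*\<xi>*5" using x6 by (intro mult_left_mono) auto
    moreover have "YS \<le> 24" using r by (auto simp: YS_def offset_def)
    moreover have "pot s \<alpha> \<zeta>\<^sub>0 \<le> 2*\<xi> + 5" using r pz by (auto simp: pot_def offset_def)
    ultimately show False using D pt(1) pm y2 x6 by linarith
  qed
  then have odd: "\<alpha> mod 6 = 1 \<or> \<alpha> mod 6 = 3 \<or> \<alpha> mod 6 = 5" using xi(3) by presburger
  have y12: "Y2 \<ge> 12" using y2 x3 by simp
  have r3: "\<alpha> mod 6 = 3"
  proof (rule ccontr)
    assume "\<not> ?thesis"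
    then have "\<alpha> mod 6 = 1 \<or> \<alpha> mod 6 = 5" using odd by simp
    then have "YS \<le> 4" "pot s \<alpha> \<zeta>\<^sub>0 \<le> 0" using pz(2) by (auto simp: YS_def offset_def pot_def)
    then show False using D pt(1) pm y12 by linarith
  qed
  have z5: "\<zeta>\<^sub>0 = 3" using pz x3 r3 by (simp add: offset_def)
  have pp: "pot s \<alpha> \<zeta>\<^sub>0 \<le> - 10" using r3 z5 by (simp add: pot_def)
  have "\<zeta> = 0"
  proof (rule ccontr)
    assume "\<zeta> \<noteq> 0"
    then have "y \<le> -5" using z x3 by (simp add: y_def)
    then have "0 \<le> (-5 - y)*(4 - y)" by (intro mult_nonneg_nonneg) auto
    then have "Y2 \<ge> 40" by (simp add: Y2_def algebra_simps)
    moreover have "YS = 24" using r3 by (simp add: YS_def offset_def)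
    ultimately show False using D pt(1) pm pp by linarith
  qed
  moreover have "p = 0"
  proof (rule ccontr)
    assume "p \<noteq> 0"
    then have "PT \<ge> 4" using pt(2) by simp
    moreover have "YS = 24" using r3 by (simp add: YS_def offset_def)
    ultimately show False using D pm pp y12 by linarith
  qed
  ultimately show ?thesis using r3 x3 by simp
qed

text \<open>The columns of the identity part: \<open>q \<ge> 0\<close> forces \<open>y \<ge> \<alpha> + 2 p\<close>, and \<open>2 y (y + 1)\<close> increases in this range.\<close>

lemma cost_right:
  fixes s \<alpha> \<xi> p \<zeta> \<zeta>\<^sub>0 :: int
  assumes s: "s = 1 \<or> s = 2 \<or> s = 3" and xi: "\<xi> \<ge> 3" and a: "\<alpha> \<ge> 2"
    and z0: "2*\<zeta>\<^sub>0 = \<xi> + \<alpha>" and z: "3 dvd (\<zeta> - \<zeta>\<^sub>0 + p)" and p: "p \<ge> 0" and q: "\<zeta> \<ge> \<zeta>\<^sub>0 + p"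
    and le: "cost s \<alpha> \<xi> p \<zeta> \<le> cost s \<alpha> \<xi> 0 \<zeta>\<^sub>0"
  shows "p = 0 \<and> \<zeta> = \<zeta>\<^sub>0"
proof -
  define \<sigma> where "\<sigma> = \<zeta> - \<zeta>\<^sub>0"
  have sg: "\<zeta> = \<zeta>\<^sub>0 + \<sigma>" "\<sigma> \<ge> p" "3 dvd (\<sigma> + p)" using q z by (auto simp: \<sigma>_def)
  have z3: "\<zeta>\<^sub>0 \<ge> 3" "\<zeta> \<ge> 3" using z0 xi a q p by linarith+
  have D: "2*p*(2*\<xi> - 4*s + 2*p + 3) + 4*\<sigma>*(2*\<alpha> + 2*\<sigma> + 1) + pot s (\<alpha>+p) \<zeta> - pot s \<alpha> \<zeta>\<^sub>0 \<le> 0"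
  proof -
    have e: "2*\<zeta> - \<xi> = \<alpha> + 2*\<sigma>" "2*\<zeta>\<^sub>0 - \<xi> = \<alpha>" using z0 sg by auto
    show ?thesis using le unfolding cost_def e by (auto simp: algebra_simps split: if_splits)
  qed
  show ?thesis
  proof (cases "p = 0")
    case True
    have "pot s (\<alpha>+p) \<zeta> - pot s \<alpha> \<zeta>\<^sub>0 \<ge> - 4*\<sigma>" using True z3 sg p by (simp add: pot_def)
    then have "4*\<sigma>*(2*\<alpha> + 2*\<sigma>) \<le> 0" using D True by (simp add: algebra_simps)
    moreover have "\<sigma> > 0 \<Longrightarrow> 4*\<sigma>*(2*\<alpha> + 2*\<sigma>) > 0" using a by (intro mult_pos_pos) auto
    ultimately show ?thesis using True sg p by force
  next
    case False
    then have p1: "p \<ge> 1" using p by simp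
    have s2: "\<sigma> \<ge> 2" using sg p1 by presburger
    have "pot s (\<alpha>+p) \<zeta> \<ge> - 4*\<zeta> - 9" using z3 by (simp add: pot_def)
    moreover have "pot s \<alpha> \<zeta>\<^sub>0 \<le> 4*\<zeta>\<^sub>0 - 4" using z3 s by (auto simp: pot_def)
    moreover have "2*p*(2*\<xi> - 4*s + 2*p + 3) \<ge> 4*\<xi> - 14"
    proof -
      have "0 \<le> (p-1)*(4*\<xi> - 12 + 4*(p-1) + 2)" using p1 xi by (intro mult_nonneg_nonneg) auto
      moreover have "s * p \<le> 3 * p" using s p1 by auto
      ultimately show ?thesis by (simp add: algebra_simps)
    qed
    moreover have "4*\<sigma>*(2*\<alpha> + 2*\<sigma> + 1) \<ge> 8*(2*\<alpha> + 1) + 8*(2*\<sigma>)"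
    proof -
      have "0 \<le> (\<sigma> - 2)*(4*(2*\<alpha> + 2*\<sigma> + 1))" using s2 a by (intro mult_nonneg_nonneg) auto
      then show ?thesis by (simp add: algebra_simps)
    qed
    ultimately show ?thesis using D z0 sg s2 a by (simp add: algebra_simps)
  qed
qed

text \<open>Comparing the costs of a slide in each of its forms shows that none of them beats the matching.\<close>

lemma slide_cost:
  assumes s: "s = 1 \<or> s = 2 \<or> s = 3" and xi: "3 dvd \<xi>" "even (\<xi> - \<alpha>)" and p: "s = 3 \<Longrightarrow> p \<noteq> 1"
    and "slide cr \<alpha> \<xi> (\<alpha> + p) \<zeta>"
  shows "cost s \<alpha> \<xi> (hstep s \<alpha> \<xi>) (layer s \<alpha> \<xi>) \<le> cost s \<alpha> \<xi> p \<zeta>"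
proof -
  note sl = step_layer[OF xi(2), of s]
  from assms(5) consider
      (up) "\<alpha> mod 6 = 2" "\<alpha> < 0" "\<xi> > 0" "p = 0" "2 * \<zeta> = \<xi> + 2"
    | (base) "\<alpha> mod 6 = 2" "\<alpha> < 0" "\<xi> = 0" "p = 0" "\<zeta> = 1"
    | (across) "\<alpha> mod 6 = 2" "\<alpha> < 0" "\<xi> > 0" "p = 1" "2 * \<zeta> = \<xi>"
    | (down) "\<alpha> mod 6 = 3" "\<alpha> < 0" "\<xi> > 0" "p = 0" "2 * \<zeta> = \<xi> - 3"
    unfolding slide_def by fastforce
  then show ?thesis
  proof cases
    case up
    have z: "2 * layer s \<alpha> \<xi> = \<xi> - 4" "hstep s \<alpha> \<xi> = 0" using sl up by (simp_all add: offset_def)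
    have "\<xi> \<ge> 6" using up xi by presburger
    then have "layer s \<alpha> \<xi> > 0" "\<zeta> = layer s \<alpha> \<xi> + 3" "2 * layer s \<alpha> \<xi> - \<xi> = -4" "2 * \<zeta> - \<xi> = 2" using z up by linarith+
    then show ?thesis using z up unfolding cost_def by (simp add: pot_def)
  next
    case across
    have z: "2 * layer s \<alpha> \<xi> = \<xi> - 4" "hstep s \<alpha> \<xi> = 0" using sl across by (simp_all add: offset_def)
    have t: "(\<alpha> + 1) mod 6 = 3" using across by presburger
    have "\<xi> \<ge> 6" using across xi by presburger
    define L where "L = layer s \<alpha> \<xi>"
    have l: "\<xi> = 2*L + 4" "L > 0" "\<zeta> = L + 2" using z across \<open>\<xi> \<ge> 6\<close> unfolding L_def by linarith+
    have "s = 1 \<or> s = 2" using s p across by auto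
    then have "cost s \<alpha> (2*L + 4) 0 L \<le> cost s \<alpha> (2*L + 4) 1 (L + 2)"
      using l(2) t across(1) by (elim disjE) (simp_all add: cost_def pot_def algebra_simps)
    then show ?thesis unfolding L_def[symmetric] z(2) across(4) l(3) using l(1) by simp
  next
    case down
    have z: "2 * layer s \<alpha> \<xi> = \<xi> + 3" "hstep s \<alpha> \<xi> = 0" using sl down by (simp_all add: offset_def)
    have "\<xi> \<ge> 3" using down xi by presburger
    then have "layer s \<alpha> \<xi> \<ge> 3" "\<zeta> = layer s \<alpha> \<xi> - 3" "2 * layer s \<alpha> \<xi> - \<xi> = 3" "2 * \<zeta> - \<xi> = -3" using z down by linarith+
    then show ?thesis using z down s unfolding cost_def by (auto simp: pot_def)
  next
    case base
    have r: "res3 s \<alpha> = (2 + s) mod 3" "res2 s \<alpha> = (2 + s) mod 3 mod 2" using base(1) unfolding res3_def res2_def by presburger+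
    have z: "2 * layer s \<alpha> \<xi> = res2 s \<alpha> - res3 s \<alpha>" "2 * hstep s \<alpha> \<xi> = 2 * s - (res3 s \<alpha> + res2 s \<alpha>)" using sl base by simp_all
    have "(\<alpha> + 1) mod 6 = 3" "(\<alpha> + 2) mod 6 = 4" using base(1) by presburger+
    moreover have "s = 1 \<and> layer s \<alpha> \<xi> = 0 \<and> hstep s \<alpha> \<xi> = 1 \<or> s = 2 \<and> layer s \<alpha> \<xi> = 0 \<and> hstep s \<alpha> \<xi> = 1
        \<or> s = 3 \<and> layer s \<alpha> \<xi> = -1 \<and> hstep s \<alpha> \<xi> = 2"
      using s by (elim disjE) (use z r in simp_all)
    ultimately show ?thesis unfolding base(3-5) by (elim disjE conjE) (simp_all add: cost_def pot_def base(1))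
  qed
qed

text \<open>The hypothesis \<open>s = 3 \<Longrightarrow> p \<noteq> 1\<close> reflects that no multiplier of the matching has \<open>p = 1\<close> in this case. There
a crossing would be cheaper than the matching.\<close>

lemma cost_tight:
  assumes s: "s \<ge> 1" "s \<le> 3 \<or> \<xi> \<le> 0 \<and> \<zeta> \<le> 0" and xi: "3 dvd \<xi>" "even (\<xi> - \<alpha>)"
    and z: "3 dvd (\<zeta> + \<alpha> + p)" and p: "p \<ge> 0" "s = 3 \<Longrightarrow> p \<noteq> 1" and q: "2*\<zeta> - \<xi> \<ge> \<alpha> + 2*p"
    and neg: "\<xi> \<le> 0 \<Longrightarrow> \<alpha> < 0 \<and> layer s \<alpha> \<xi> \<le> 0" and pos: "\<xi> > 0 \<Longrightarrow> layer s \<alpha> \<xi> > 0"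
    and le: "cost s \<alpha> \<xi> p \<zeta> \<le> cost s \<alpha> \<xi> (hstep s \<alpha> \<xi>) (layer s \<alpha> \<xi>)"
  shows "p = hstep s \<alpha> \<xi> \<and> \<zeta> = layer s \<alpha> \<xi> \<or> s \<le> 3 \<and> slide (s \<noteq> 3) \<alpha> \<xi> (\<alpha> + p) \<zeta>"
proof -
  note sl = step_layer[OF xi(2), of s]
  show ?thesis
  proof (cases "\<xi> \<le> 0")
    case True
    note e = sl(1,2)[OF True]
    show ?thesis
    proof (cases "\<zeta> \<le> 0")
      case z0: True
      show ?thesis using cost_bottom_bottom[OF xi z0 z e _ le] neg True by simp
    next
      case False
      then have "\<zeta> > 0" "s = 1 \<or> s = 2 \<or> s = 3" using s by auto
      from cost_bottom_top[OF this(2) True xi this(1) z p(1) p(2) e _ le] neg True s False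
      show ?thesis by (auto simp: slide_def)
    qed
  next
    case False
    then have x0: "\<xi> > 0" and s3: "s = 1 \<or> s = 2 \<or> s = 3" using s by auto
    have x3: "\<xi> \<ge> 3" using x0 xi(1) by presburger
    have p0: "hstep s \<alpha> \<xi> = 0" using sl x0 by simp
    note le' = le[unfolded p0]
    show ?thesis
    proof (cases "\<alpha> \<ge> 2")
      case True
      have l: "2 * layer s \<alpha> \<xi> = \<xi> + \<alpha>" using sl x0 True by simp
      have "3 dvd (\<zeta> - layer s \<alpha> \<xi> + p)" using z l xi(1) by presburger
      moreover have "\<zeta> \<ge> layer s \<alpha> \<xi> + p" using l q by linarith
      ultimately show ?thesis using cost_right[OF s3 x3 True l _ p(1) _ le'] p0 by simp
    next
      case False
      then have l: "2 * layer s \<alpha> \<xi> = \<xi> + offset \<alpha>" using sl x0 by simp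
      show ?thesis
      proof (cases "\<zeta> \<le> 0")
        case True
        from cost_top_bottom[OF s3 x0 xi True z p(1) p(2) l pos[OF x0] le']
        have "\<alpha> mod 6 = 3" "p = 0" "2*\<zeta> = \<xi> - 3" by auto
        moreover have "\<alpha> < 0" using \<open>\<alpha> mod 6 = 3\<close> False by presburger
        ultimately show ?thesis using s3 x0 by (auto simp: slide_def)
      next
        case zp: False
        then have "\<zeta> > 0" by simp
        from cost_top_top[OF s3 x0 xi this z p(1) p(2) l pos[OF x0] le']
        have *: "p = 0 \<and> \<zeta> = layer s \<alpha> \<xi> \<or> \<alpha> mod 6 = 2 \<and> p = 0 \<and> 2*\<zeta> = \<xi> + 2
          \<or> \<alpha> mod 6 = 2 \<and> p = 1 \<and> 2*\<zeta> = \<xi> \<or> \<alpha> mod 6 = 3 \<and> p = 0 \<and> 2*\<zeta> = \<xi> - 3" .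
        have "\<alpha> mod 6 = 2 \<or> \<alpha> mod 6 = 3 \<Longrightarrow> \<alpha> < 0" using False by presburger
        then show ?thesis using * p0 s3 x0 p(2) by (auto simp: slide_def)
      qed
    qed
  qed
qed

lemma cost_minimal:
  assumes s: "s \<ge> 1" "s \<le> 3 \<or> \<xi> \<le> 0 \<and> \<zeta> \<le> 0" and xi: "3 dvd \<xi>" "even (\<xi> - \<alpha>)"
    and z: "3 dvd (\<zeta> + \<alpha> + p)" and p: "p \<ge> 0" "s = 3 \<Longrightarrow> p \<noteq> 1" and q: "2*\<zeta> - \<xi> \<ge> \<alpha> + 2*p"
    and neg: "\<xi> \<le> 0 \<Longrightarrow> \<alpha> < 0 \<and> layer s \<alpha> \<xi> \<le> 0" and pos: "\<xi> > 0 \<Longrightarrow> layer s \<alpha> \<xi> > 0"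
  shows "cost s \<alpha> \<xi> (hstep s \<alpha> \<xi>) (layer s \<alpha> \<xi>) \<le> cost s \<alpha> \<xi> p \<zeta>"
proof (rule ccontr)
  assume *: "\<not> ?thesis"
  then have "cost s \<alpha> \<xi> p \<zeta> \<le> cost s \<alpha> \<xi> (hstep s \<alpha> \<xi>) (layer s \<alpha> \<xi>)" by simp
  from cost_tight[OF assms this] show False
  proof
    assume "p = hstep s \<alpha> \<xi> \<and> \<zeta> = layer s \<alpha> \<xi>"
    then show False using * by blast
  next
    assume sl: "s \<le> 3 \<and> slide (s \<noteq> 3) \<alpha> \<xi> (\<alpha> + p) \<zeta>"
    have "s = 1 \<or> s = 2 \<or> s = 3" using sl s(1) by linarith
    from slide_cost[OF this xi p(2) conjunct2[OF sl]] show False using * by blast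
  qed
qed

section \<open>The matching on monomials\<close>

text \<open>Here \<open>side\<close>, \<open>gap\<close>, \<open>cut\<close> and \<open>slack\<close> are the numbers \<open>N\<close>, \<open>g\<close>, \<open>N\<^sub>1\<close> and \<open>s\<close>. For \<open>g \<le> 0\<close> the cut is negative
and the matching fixes every point \<open>(a, b)\<close>.\<close>

definition side :: "nat \<Rightarrow> int" where "side m = 3 * int m - 3"
definition gap :: "nat \<Rightarrow> nat \<Rightarrow> int" where "gap m w = 2 * side m - int w"
definition cut :: "nat \<Rightarrow> nat \<Rightarrow> int" where "cut m w = min (side m) (3 * ((gap m w - 1) div 3))"
definition slack :: "nat \<Rightarrow> nat \<Rightarrow> int" where "slack m w = gap m w - cut m w"

definition col :: "nat \<Rightarrow> nat \<Rightarrow> monomial \<Rightarrow> int" where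
  "col m w = (\<lambda>(a, b, c). int a - gap m w)"
definition height :: "nat \<Rightarrow> nat \<Rightarrow> monomial \<Rightarrow> int" where
  "height m w = (\<lambda>(a, b, c). int a + 2 * int b - cut m w + slack m w)"
definition level :: "nat \<Rightarrow> nat \<Rightarrow> monomial \<Rightarrow> int" where
  "level m w = (\<lambda>(i, j, k). int i + int j - cut m w)"

definition shift :: "nat \<Rightarrow> nat \<Rightarrow> monomial \<Rightarrow> monomial" where
  "shift m w u =
     (let i = int (fst u) + hstep (slack m w) (col m w u) (height m w u);
          j = cut m w + layer (slack m w) (col m w u) (height m w u) - i
      in (nat i, nat j, nat ((int w + 3 * int m - i - 2 * j) div 3)))"

lemma R_monsD:
  assumes "(a, b, c) \<in> R_mons m w" "m > 0"
  shows "int a + 2 * int b + 3 * int c = int w" "int a + int b \<le> side m"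
  using assms by (auto simp: R_mons_def wt_def side_def)

lemma M_mons_iff:
  assumes "m > 0"
  shows "(i, j, k) \<in> M_mons m w \<longleftrightarrow>
    int i + 2 * int j + 3 * int k = int w + 3 * int m \<and> int i + int j \<le> side m \<and> 2 * int i + int j \<ge> gap m w"
proof -
  have "i + 2 * j + 3 * k = w + 3 * m \<longleftrightarrow> int i + 2 * int j + 3 * int k = int w + 3 * int m"
    by (metis (mono_tags, lifting) of_nat_add of_nat_eq_iff of_nat_mult of_nat_numeral)
  then show ?thesis using assms by (auto simp: M_mons_def wt_def side_def gap_def)
qed

lemma shift_props:
  assumes m: "m > 0" and u: "u \<in> R_mons m w"
  defines "s \<equiv> slack m w" and "\<alpha> \<equiv> col m w u" and "\<xi> \<equiv> height m w u"
  shows "shift m w u \<in> M_mons m w" "mon_divides u (shift m w u)"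
    "col m w (shift m w u) = \<alpha> + hstep s \<alpha> \<xi>" "level m w (shift m w u) = layer s \<alpha> \<xi>"
    "s \<ge> 1" "s \<le> 3 \<or> \<xi> \<le> 0" "3 dvd \<xi>" "even (\<xi> - \<alpha>)" "3 dvd cut m w"
    "\<xi> \<le> 0 \<Longrightarrow> \<alpha> < 0 \<and> layer s \<alpha> \<xi> \<le> 0" "\<xi> > 0 \<Longrightarrow> layer s \<alpha> \<xi> > 0"
    "s = 3 \<Longrightarrow> hstep s \<alpha> \<xi> \<noteq> 1"
proof -
  obtain a b c where abc: "u = (a, b, c)" by (cases u)
  define p \<zeta> where "p = hstep s \<alpha> \<xi>" and "\<zeta> = layer s \<alpha> \<xi>"
  define i j where "i = int a + p" and "j = cut m w + \<zeta> - i"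
  note R = R_monsD[OF u[unfolded abc] m]
  have al: "\<alpha> = int a - gap m w" and xi: "\<xi> = int a + 2 * int b - cut m w + s"
    by (simp_all add: \<alpha>_def \<xi>_def s_def col_def height_def abc)
  note T = target_arith[of "side m" "int m - 1" "int a" "int b" "int c" "int w" "gap m w" "cut m w" s \<alpha> \<xi> p \<zeta> i j,
      OF _ _ _ _ _ R gap_def cut_def s_def[THEN meta_eq_to_obj_eq, unfolded slack_def] al xi p_def \<zeta>_def i_def j_def]
  have n: "side m = 3 * (int m - 1)" "int m - 1 \<ge> 0" "int a \<ge> 0" "int b \<ge> 0" "int c \<ge> 0" using m by (simp_all add: side_def)
  note T = T[OF n]
  show "s \<ge> 1" "s \<le> 3 \<or> \<xi> \<le> 0" "3 dvd \<xi>" "even (\<xi> - \<alpha>)" "3 dvd cut m w" by (fact T)+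
  show "\<xi> \<le> 0 \<Longrightarrow> \<alpha> < 0 \<and> layer s \<alpha> \<xi> \<le> 0" "\<xi> > 0 \<Longrightarrow> layer s \<alpha> \<xi> > 0" "s = 3 \<Longrightarrow> hstep s \<alpha> \<xi> \<noteq> 1"
    using T(12-14) unfolding \<zeta>_def p_def by blast+
  have "3 dvd (int w + 3 * int m - i - 2 * j)" using T(10) by presburger
  then obtain k where k: "int w + 3 * int m - i - 2 * j = 3 * k" by (auto simp: dvd_def)
  have ck: "int c \<le> k" using k T(11) R by (simp add: side_def)
  have v: "shift m w u = (nat i, nat j, nat k)"
    using k by (simp add: shift_def Let_def abc[symmetric] i_def j_def p_def \<zeta>_def \<alpha>_def \<xi>_def s_def) (simp add: abc)
  have nn: "i \<ge> 0" "j \<ge> 0" "k \<ge> 0" using T(6,7) ck by linarith+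
  show "shift m w u \<in> M_mons m w"
    unfolding v M_mons_iff[OF m] using nn T(8,9) k by simp
  have "(nat i, nat j, nat k) = (a, b, c) + (nat i - a, nat j - b, nat k - c)"
    using T(6,7) ck by auto
  then show "mon_divides u (shift m w u)" unfolding mon_divides_def v unfolding abc by blast
  show "col m w (shift m w u) = \<alpha> + hstep s \<alpha> \<xi>" "level m w (shift m w u) = layer s \<alpha> \<xi>"
    using nn unfolding v by (simp_all add: col_def level_def al i_def j_def p_def \<zeta>_def)
qed

lemma R_mons_coords_inj:
  assumes "u \<in> R_mons m w" "u' \<in> R_mons m w" "col m w u = col m w u'" "height m w u = height m w u'"
  shows "u = u'"
  using assms by (auto simp: R_mons_def wt_def col_def height_def)

lemma M_mons_coords_inj:
  assumes "v \<in> M_mons m w" "v' \<in> M_mons m w" "col m w v = col m w v'" "level m w v = level m w v'"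
  shows "v = v'"
  using assms by (auto simp: M_mons_def wt_def col_def level_def)

text \<open>The rotation \<open>(a, b, e) \<mapsto> (e, a, b)\<close> of the triangle, where \<open>e = N - a - b\<close>, maps one set onto the other.\<close>

lemma card_R_mons_eq_M_mons:
  assumes m: "m > 0"
  shows "card (R_mons m w) = card (M_mons m w)"
proof -
  define N where "N = 3 * m - 3"
  have N: "3 * m = N + 3" using m by (simp add: N_def)
  have "bij_betw (\<lambda>(a, b, c). (N - a - b, a, b + c + 1)) (R_mons m w) (M_mons m w)"
    by (rule bij_betw_byWitness[where f' = "\<lambda>(i, j, k). (j, N - i - j, i + j + k - 1 - N)"])
      (use m in \<open>auto simp: R_mons_def M_mons_def wt_def N\<close>)
  then show ?thesis by (rule bij_betw_same_card)
qed

lemma finite_M_mons: "finite (M_mons m w)"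
  by (rule finite_subset[of _ "{..w + 3*m} \<times> {..w + 3*m} \<times> {..w + 3*m}"]) (auto simp: M_mons_def wt_def)

lemma shift_bij:
  assumes m: "m > 0"
  shows "bij_betw (shift m w) (R_mons m w) (M_mons m w)"
proof -
  have "inj_on (shift m w) (R_mons m w)"
  proof
    fix u u' assume u: "u \<in> R_mons m w" and u': "u' \<in> R_mons m w" and eq: "shift m w u = shift m w u'"
    note P = shift_props[OF m u] and P' = shift_props[OF m u']
    have "col m w u = col m w u' \<and> height m w u = height m w u'"
      by (rule coords_inj[of _ "slack m w"]) (use P(3,4,7,8,10,11) P'(3,4,7,8,10,11) eq in auto)
    then show "u = u'" using R_mons_coords_inj[OF u u'] by blast
  qed
  moreover have "shift m w ` R_mons m w = M_mons m w"
    by (rule card_subset_eq[OF finite_M_mons])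
      (use shift_props(1)[OF m] card_image[OF \<open>inj_on (shift m w) (R_mons m w)\<close>] card_R_mons_eq_M_mons[OF m] in auto)
  ultimately show ?thesis by (simp add: bij_betw_def)
qed

theorem theorem1p2:
  fixes m w :: nat
  assumes "m > 0"
  shows "\<exists>\<phi>. bij_betw \<phi> (R_mons m w) (M_mons m w)
    \<and> (\<forall>u \<in> R_mons m w. mon_divides u (\<phi> u))
    \<and> (\<forall>\<psi>. bij_betw \<psi> (R_mons m w) (M_mons m w)
          \<and> multipliers (R_mons m w) \<psi> = multipliers (R_mons m w) \<phi>
        \<longrightarrow> evenperm (quot_perm (R_mons m w) \<psi> \<phi>))"
proof (intro exI[of _ "shift m w"] conjI ballI allI impI; (elim conjE)?)
  note m = assms
  show "bij_betw (shift m w) (R_mons m w) (M_mons m w)" by (rule shift_bij[OF m])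
  show "mon_divides u (shift m w u)" if "u \<in> R_mons m w" for u by (rule shift_props(2)[OF m that])
  fix \<psi> assume psi: "bij_betw \<psi> (R_mons m w) (M_mons m w)"
    and mult: "multipliers (R_mons m w) \<psi> = multipliers (R_mons m w) (shift m w)"
  define s where "s = slack m w"
  define ht where "ht = height m w"
  define C where "C u v = cost s (col m w u) (ht u) (col m w v - col m w u) (level m w v)" for u v
  (* The splitting of the cost into functions of the source, of the target and of the multiplier. *)
  define g h K where
    "g = (\<lambda>(a, b, c :: nat). let a = int a; b = int b; g = gap m w in
       (a + 2*b - g) * (a + 2*b - g + 3) + 2 * (a - g) * (a - g + 1) - 6*a*a - 8*a*b)"
    and "h = (\<lambda>(i, j, k :: nat). let i = int i; j = int j in
       6*i*i + 8*i*j + pot s (i - gap m w) (i + j - cut m w))"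
    and "K = (\<lambda>(p, q, r :: int). let g = gap m w in
       4*p*p + 6*p - 4*g*p + 8*(p+q)*(p+q) + 4*(p+q) - 8*g*(p+q) - 6*p*p - 8*p*q + (if s = 2 \<and> p mod 6 = 2 then 7 else 0))"
  have split: "C u v = g u + h v + K (mon_quot v u)" for u v
  proof -
    obtain a b c i j k where uv: "u = (a, b, c)" "v = (i, j, k)" by (cases u, cases v)
    have p: "int i - gap m w - (int a - gap m w) = int i - int a" by simp
    show ?thesis
      unfolding C_def g_def h_def K_def mon_quot_def col_def ht_def height_def level_def s_def uv prod.case Let_def p
      by (rule cost_splits[OF slack_def refl refl])
  qed
  have facts: "C u (shift m w u) = cost s (col m w u) (ht u) (hstep s (col m w u) (ht u)) (layer s (col m w u) (ht u))"
    if "u \<in> R_mons m w" for u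
    using shift_props(3,4)[OF m that] by (simp add: C_def s_def ht_def)
  (* The multipliers of \<psi> are multipliers of the matching, which gives p, q \<ge> 0 and the exclusion of p = 1. *)
  have used: "\<exists>u'\<in>R_mons m w. mon_quot (\<psi> u) u = mon_quot (shift m w u') u'" if "u \<in> R_mons m w" for u
  proof -
    have "mon_quot (\<psi> u) u \<in># multipliers (R_mons m w) \<psi>"
      using that finite_R_mons by (simp add: multipliers_def)
    then show ?thesis unfolding mult using finite_R_mons by (auto simp: multipliers_def)
  qed
  have hyps: "s \<ge> 1 \<and> (s \<le> 3 \<or> ht u \<le> 0 \<and> level m w (\<psi> u) \<le> 0) \<and> 3 dvd ht u \<and> even (ht u - col m w u) \<and>
     3 dvd (level m w (\<psi> u) + col m w u + p) \<and> p \<ge> 0 \<and> (s = 3 \<longrightarrow> p \<noteq> 1) \<and> 2 * level m w (\<psi> u) - ht u \<ge> col m w u + 2*p \<and>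
     (ht u \<le> 0 \<longrightarrow> col m w u < 0 \<and> layer s (col m w u) (ht u) \<le> 0) \<and> (ht u > 0 \<longrightarrow> layer s (col m w u) (ht u) > 0)"
    if u: "u \<in> R_mons m w" and p: "p = col m w (\<psi> u) - col m w u" for u p
  proof -
    note P = shift_props[OF m u, folded s_def ht_def]
    obtain a b c i j k where uv: "u = (a, b, c)" "\<psi> u = (i, j, k)" by (cases u, cases "\<psi> u")
    have v: "\<psi> u \<in> M_mons m w" using psi u by (auto simp: bij_betw_def)
    note M = v[unfolded uv(2) M_mons_iff[OF m]] and R = R_monsD[OF u[unfolded uv(1)] m]
    obtain u' where u': "u' \<in> R_mons m w" "mon_quot (\<psi> u) u = mon_quot (shift m w u') u'" using used[OF u] by blast
    obtain a' b' c' i' j' k' where uv': "u' = (a', b', c')" "shift m w u' = (i', j', k')" by (cases u', cases "shift m w u'")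
    have d: "i' \<ge> a'" "j' \<ge> b'" using shift_props(2)[OF m u'(1)] unfolding mon_divides_def uv'(2) unfolding uv'(1) by auto
    have pq: "int i - int a = int i' - int a'" "int j - int b = int j' - int b'"
      using u'(2) unfolding uv(2) uv'(2) unfolding uv(1) uv'(1) by (simp_all add: mon_quot_def)
    have p': "p = hstep s (col m w u') (ht u')"
      using shift_props(3)[OF m u'(1), folded s_def ht_def] pq(1) unfolding p uv(2) uv'(2) unfolding uv(1) uv'(1) by (simp add: col_def)
    have p0: "p \<ge> 0" "int j \<ge> int b" using d pq unfolding p uv(2) unfolding uv(1) by (simp_all add: col_def)
    have "s = 3 \<longrightarrow> p \<noteq> 1" unfolding p' using shift_props(12)[OF m u'(1), folded s_def ht_def] by blast
    moreover have "2 * level m w (\<psi> u) - ht u \<ge> col m w u + 2*p"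
      using p0 unfolding p uv(2) unfolding uv(1) by (simp add: col_def level_def ht_def height_def slack_def)
    moreover have "3 dvd (level m w (\<psi> u) + col m w u + p)"
    proof -
      have "level m w (\<psi> u) + col m w u + p = 3 * (int i + int j + int k - int m - 2 * (int m - 1)) - cut m w"
        using M unfolding p uv(2) unfolding uv(1) by (simp add: col_def level_def gap_def side_def)
      then show ?thesis using P(9) by (simp add: dvd_diff)
    qed
    moreover have "s \<le> 3 \<or> ht u \<le> 0 \<and> level m w (\<psi> u) \<le> 0"
    proof (cases "s \<le> 3")
      case False
      have "gap m w - 3 * ((gap m w - 1) div 3) \<le> 3" by presburger
      then have "cut m w = side m"
        using False unfolding s_def slack_def cut_def by (simp add: min_def split: if_splits)
      then show ?thesis using P(6) False M unfolding uv(2) by (auto simp: level_def)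
    qed simp
    ultimately show ?thesis using P p0 by blast
  qed
  have le: "C u (shift m w u) \<le> C u (\<psi> u)" if "u \<in> R_mons m w" for u
    unfolding facts[OF that] unfolding C_def
    by (rule cost_minimal) (use hyps[OF that refl] in blast)+
  have eq: "C u (\<psi> u) = C u (shift m w u)" if "u \<in> R_mons m w" for u
    by (rule tight_of_same_multiset[where \<mu> = mon_quot, OF finite_R_mons shift_bij[OF m] psi
          mult[unfolded multipliers_def] split le that])
  show "evenperm (quot_perm (R_mons m w) \<psi> (shift m w))"
  proof (rule even_slides[where \<alpha> = "col m w" and \<xi> = ht and \<tau> = "col m w" and \<zeta> = "level m w" and cr = "s \<le> 3 \<and> s \<noteq> 3",
        OF finite_R_mons shift_bij[OF m]])
    fix u assume u: "u \<in> R_mons m w"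
    note P = shift_props[OF m u, folded s_def ht_def]
    note sl = step_layer[OF P(8), of s]
    show "col m w (shift m w u) = col m w u" if "ht u > 0" using P(3) sl(3) that by simp
    show "level m w (shift m w u) \<le> 0" if "ht u \<le> 0" using P(4,10) that by simp
    show "2 * level m w (shift m w u) = ht u - 4" if "ht u > 0" "col m w u < 0" "col m w u mod 6 = 2"
      using P(4) sl(5) that by (simp add: offset_def)
    show "2 * level m w (shift m w u) = ht u + 3" if "ht u > 0" "col m w u < 0" "col m w u mod 6 = 3"
      using P(4) sl(5) that by (simp add: offset_def)
    show "col m w (shift m w u) = col m w u + 1 \<and> level m w (shift m w u) = 0"
      if "ht u = 0" "col m w u < 0" "col m w u mod 6 = 2" "s \<le> 3 \<and> s \<noteq> 3"
    proof -
      have "res3 s (col m w u) = (2 + s) mod 3" "res2 s (col m w u) = (2 + s) mod 3 mod 2"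
        using that(3) unfolding res3_def res2_def by presburger+
      moreover have "s = 1 \<or> s = 2" using that(4) P(5) by auto
      ultimately show ?thesis using P(3,4) sl(1,2) that(1) by (elim disjE) simp_all
    qed
  next
    show "\<forall>u\<in>R_mons m w. \<psi> u = shift m w u \<or> slide (s \<le> 3 \<and> s \<noteq> 3) (col m w u) (ht u) (col m w (\<psi> u)) (level m w (\<psi> u))"
    proof
      fix u assume u: "u \<in> R_mons m w"
      note P = shift_props[OF m u, folded s_def ht_def]
      define p where "p = col m w (\<psi> u) - col m w u"
      have "cost s (col m w u) (ht u) p (level m w (\<psi> u))
          \<le> cost s (col m w u) (ht u) (hstep s (col m w u) (ht u)) (layer s (col m w u) (ht u))"
        using eq[OF u] unfolding facts[OF u] unfolding C_def p_def by simp
      then have "p = hstep s (col m w u) (ht u) \<and> level m w (\<psi> u) = layer s (col m w u) (ht u)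
          \<or> s \<le> 3 \<and> slide (s \<noteq> 3) (col m w u) (ht u) (col m w u + p) (level m w (\<psi> u))"
        by (rule cost_tight[rotated -1]) (use hyps[OF u p_def] in blast)+
      moreover have "\<psi> u = shift m w u" if "p = hstep s (col m w u) (ht u)" "level m w (\<psi> u) = layer s (col m w u) (ht u)"
        using M_mons_coords_inj[of "\<psi> u" m w "shift m w u"] P(1,3,4) that psi u
        by (auto simp: p_def bij_betw_def)
      moreover have "col m w u + p = col m w (\<psi> u)" by (simp add: p_def)
      ultimately show "\<psi> u = shift m w u \<or> slide (s \<le> 3 \<and> s \<noteq> 3) (col m w u) (ht u) (col m w (\<psi> u)) (level m w (\<psi> u))"
        by auto
    qed
  next
    show "bij_betw \<psi> (R_mons m w) (M_mons m w)" by (rule psi)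
    show "u = u'" if "u \<in> R_mons m w" "u' \<in> R_mons m w" "col m w u = col m w u'" "ht u = ht u'" for u u'
      using R_mons_coords_inj that unfolding ht_def by blast
    show "v = v'" if "v \<in> M_mons m w" "v' \<in> M_mons m w" "col m w v = col m w v'" "level m w v = level m w v'" for v v'
      using M_mons_coords_inj that by blast
  qed
qed

end
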